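(* Let $\kappa$ be a perfect field of prime characteristic $p$ and $S=\kappa[x_1,\dots,x_n]$. Let $I\subseteq S$ be an ideal, write $C=C(x_n,I)$ and $N=N(x_n,I)$, and suppose that $\mathrm{in}_{x_n}(I)=C\cap (N+(x_n))$ is a nondegenerate geometric vertex decomposition. Assume that $g\in S$ has no term divisible by $x_n$ and that $\mathrm{Tr}((x_ng)^{p-1}\bullet)$ is a Frobenius splitting of $S$ that simultaneously compatibly splits $C$ and $N$. Suppose further that there exists $u\in C\setminus\bigcup_{P\in \mathrm{Ass}(N)}P$ such that $u\mid g$. Then there exists $r\in S$ with no term divisible by $x_n$ such that $\mathrm{Tr}((x_ng+r)^{p-1}\bullet)$ is a Frobenius splitting of $S$ that compatibly splits $I$. Specifically, $r$ can be taken so that $x_ng+r\in I$ is a representative of the image of the class of $g$ under the isomorphism $\psi: C/N\to I/N$ described in the context.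
   Context: **Frobenius splittings.** For a ring $R$ of prime characteristic $p$, a Frobenius splitting of $R$ is an additive map $\varphi:R\to R$ with $\varphi(a^pb)=a\varphi(b)$ for all $a,b\in R$ and $\varphi(1)=1$ (equivalently, an $R$-linear map $F_*R\to R$ splitting the Frobenius map). An ideal $I\subseteq R$ is compatibly split by $\varphi$ if $\varphi(I)\subseteq I$. **Trace map.** $\mathrm{Tr}:S\to S$ is the additive map with $\mathrm{Tr}(am)=a^{1/p}\,\mathrm{Tr}(m)$ for $a\in\kappa$ and $m$ a monomial, where $\mathrm{Tr}(m)=\frac{\sqrt[p]{m\,x_1\cdots x_n}}{x_1\cdots x_n}$ if $m\,x_1\cdots x_n$ is a $p$-th power of a monomial, and $\mathrm{Tr}(m)=0$ otherwise. For $h\in S$, $\mathrm{Tr}(h\,\bullet)$ denotes the map $a\mapsto \mathrm{Tr}(ha)$. **Geometric vertex decomposition.** For $0\ne f\in S$, $\mathrm{in}_{x_n}(f)$ is the sum of the terms of $f$ of highest degree in $x_n$, and $\mathrm{in}_{x_n}(I)=(\mathrm{in}_{x_n}(f)\mid f\in I)$. Set $C(x_n,I)=\mathrm{in}_{x_n}(I):x_n^\infty$, and let $N(x_n,I)$ be the ideal of $S$ generated by the elements $f\in I$ having no term divisible by $x_n$. The equality $\mathrm{in}_{x_n}(I)=C(x_n,I)\cap(N(x_n,I)+(x_n))$ is called a geometric vertex decomposition if it holds and, in addition, either $\sqrt{C(x_n,I)}=\sqrt{N(x_n,I)}$ or no minimal prime of $C(x_n,I)$ is a minimal prime of $N(x_n,I)$.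 It is degenerate if $C(x_n,I)=(1)$ or $\sqrt{C(x_n,I)}=\sqrt{N(x_n,I)}$, and nondegenerate otherwise. **The isomorphism $\psi$.** In the nondegenerate case with $N=N(x_n,I)$ having no embedded primes (which is automatic here, since compatibly split ideals are radical), there exist $q\in C$ and $x_nq+r_0\in I$, both nonzerodivisors modulo $N$, with no term of $q$ or $r_0$ divisible by $x_n$. For each $f\in C$ there is $g_f\in I$ with $f(x_nq+r_0)-g_fq\in N$; the class $\overline{g_f}\in I/N$ is uniquely determined by $f$, and $\overline f\mapsto\overline{g_f}$ defines an $S$-module isomorphism $\psi:C/N\to I/N$ (informally, multiplication by $(x_nq+r_0)/q$). *)

theory Defs
  imports
    "HOL-Computational_Algebra.Computational_Algebra"
    "HOL-Library.Poly_Mapping"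
    "HOL-Library.Set_Algebras"
begin

text \<open>
  The polynomial ring \<open>S = k[x\<^sub>1, \<dots>, x\<^sub>n]\<close> is the type of finitely supported functions from
  exponent vectors \<open>'n \<Rightarrow>\<^sub>0 nat\<close> to coefficients, with \<open>n = CARD('n)\<close>.  The distinguished variable
  \<open>x\<^sub>n\<close> is \<open>var y\<close> for an arbitrary index \<open>y :: 'n\<close>.
\<close>

type_synonym ('n, 'k) mpol = "('n \<Rightarrow>\<^sub>0 nat) \<Rightarrow>\<^sub>0 'k"

definition var :: "'n \<Rightarrow> ('n, 'k::comm_ring_1) mpol" where
  "var i = Poly_Mapping.single (Poly_Mapping.single i 1) 1"

definition const :: "'k \<Rightarrow> ('n, 'k::comm_ring_1) mpol" where
  "const c = Poly_Mapping.single 0 c"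

definition free_of :: "'n \<Rightarrow> ('n, 'k::zero) mpol \<Rightarrow> bool" where
  "free_of y f \<longleftrightarrow> (\<forall>m\<in>Poly_Mapping.keys f. Poly_Mapping.lookup m y = 0)"


section \<open>Ideals\<close>

definition is_ideal :: "'r::comm_ring_1 set \<Rightarrow> bool" where
  "is_ideal J \<longleftrightarrow> module.subspace (*) J"

definition ideal_gen :: "'r::comm_ring_1 set \<Rightarrow> 'r set" where
  "ideal_gen B = module.span (*) B"

definition prime_ideal :: "'r::comm_ring_1 set \<Rightarrow> bool" where
  "prime_ideal P \<longleftrightarrow> is_ideal P \<and> P \<noteq> UNIV \<and> (\<forall>a b. a * b \<in> P \<longrightarrow> a \<in> P \<or> b \<in> P)"

definition minimal_primes :: "'r::comm_ring_1 set \<Rightarrow> 'r set set" where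
  "minimal_primes J =
     {P. prime_ideal P \<and> J \<subseteq> P \<and> (\<forall>Q. prime_ideal Q \<and> J \<subseteq> Q \<and> Q \<subseteq> P \<longrightarrow> Q = P)}"

text \<open>The associated primes of the module \<open>R/J\<close>: the prime ideals of the form \<open>J : b\<close>.\<close>

definition associated_primes :: "'r::comm_ring_1 set \<Rightarrow> 'r set set" where
  "associated_primes J = {P. prime_ideal P \<and> (\<exists>b. P = {a. a * b \<in> J})}"

definition ideal_radical :: "'r::comm_ring_1 set \<Rightarrow> 'r set" where
  "ideal_radical J = {a. \<exists>k. a ^ k \<in> J}"

definition saturation :: "'r::comm_ring_1 set \<Rightarrow> 'r \<Rightarrow> 'r set" where
  "saturation J x = {a. \<exists>k. x ^ k * a \<in> J}"

definition nonzerodivisor_mod :: "'r::comm_ring_1 set \<Rightarrow> 'r \<Rightarrow> bool" where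
  "nonzerodivisor_mod J a \<longleftrightarrow> (\<forall>b. a * b \<in> J \<longrightarrow> b \<in> J)"


section \<open>Quotients of ideals\<close>

text \<open>For ideals \<open>N \<subseteq> J\<close>, the elements of \<open>J/N\<close> are the cosets \<open>f +o N\<close>.  Addition of cosets is
  the elementwise sum of sets; the scalar multiple of a coset has to be saturated by \<open>N\<close>, since
  \<open>s *o (f +o N)\<close> is only a subset of the coset of \<open>s * f\<close>.\<close>

definition quotient_by :: "'r::comm_ring_1 set \<Rightarrow> 'r set \<Rightarrow> 'r set set" where
  "quotient_by J N = (\<lambda>f. f +o N) ` J"

definition coset_scale :: "'r::comm_ring_1 set \<Rightarrow> 'r \<Rightarrow> 'r set \<Rightarrow> 'r set" where
  "coset_scale N s X = (s *o X) + N"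

definition quotient_module_iso ::
    "'r::comm_ring_1 set \<Rightarrow> 'r set \<Rightarrow> 'r set \<Rightarrow> ('r set \<Rightarrow> 'r set) \<Rightarrow> bool" where
  "quotient_module_iso J K N \<psi> \<longleftrightarrow>
     bij_betw \<psi> (quotient_by J N) (quotient_by K N) \<and>
     (\<forall>X\<in>quotient_by J N. \<forall>Y\<in>quotient_by J N. \<psi> (X + Y) = \<psi> X + \<psi> Y) \<and>
     (\<forall>s. \<forall>X\<in>quotient_by J N. \<psi> (coset_scale N s X) = coset_scale N s (\<psi> X))"


section \<open>Frobenius splittings and the trace map\<close>

text \<open>In the following two notions \<open>p\<close> is the prime characteristic of the ring.\<close>

definition frobenius_splitting :: "nat \<Rightarrow> ('r::comm_ring_1 \<Rightarrow> 'r) \<Rightarrow> bool" where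
  "frobenius_splitting p \<phi> \<longleftrightarrow>
     (\<forall>a b. \<phi> (a + b) = \<phi> a + \<phi> b) \<and> (\<forall>a b. \<phi> (a ^ p * b) = a * \<phi> b) \<and> \<phi> 1 = 1"

definition compatibly_split :: "('r::comm_ring_1 \<Rightarrow> 'r) \<Rightarrow> 'r set \<Rightarrow> bool" where
  "compatibly_split \<phi> J \<longleftrightarrow> \<phi> ` J \<subseteq> J"

definition proot :: "nat \<Rightarrow> 'k::field \<Rightarrow> 'k" where
  "proot p c = (THE d. d ^ p = c)"

text \<open>For exponent vectors \<open>m\<close> and \<open>w\<close>, the equation \<open>m\<^sub>i + 1 = p (w\<^sub>i + 1)\<close> for all \<open>i\<close> says that
  \<open>x\<^sup>m x\<^sub>1\<cdots>x\<^sub>n\<close> is the \<open>p\<close>-th power of \<open>x\<^sup>w x\<^sub>1\<cdots>x\<^sub>n\<close>; the trace of \<open>x\<^sup>m\<close> is then \<open>x\<^sup>w\<close>.\<close>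

definition trace_monom :: "nat \<Rightarrow> ('n \<Rightarrow>\<^sub>0 nat) \<Rightarrow> ('n, 'k::field) mpol" where
  "trace_monom p m =
     (let root = (\<lambda>w :: 'n \<Rightarrow>\<^sub>0 nat.
            \<forall>i. Poly_Mapping.lookup m i + 1 = p * (Poly_Mapping.lookup w i + 1))
      in if \<exists>w. root w then Poly_Mapping.single (THE w. root w) 1 else 0)"

definition trace :: "nat \<Rightarrow> ('n, 'k::field) mpol \<Rightarrow> ('n, 'k) mpol" where
  "trace p f =
     (\<Sum>m\<in>Poly_Mapping.keys f. const (proot p (Poly_Mapping.lookup f m)) * trace_monom p m)"


section \<open>Geometric vertex decomposition\<close>

text \<open>Only for \<open>f = 0\<close> is the maximum below taken over the empty set, and then the sum is empty.\<close>

definition init_form :: "'n \<Rightarrow> ('n, 'k::comm_ring_1) mpol \<Rightarrow> ('n, 'k) mpol" where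
  "init_form y f =
     (let d = Max ((\<lambda>m. Poly_Mapping.lookup m y) ` Poly_Mapping.keys f)
      in \<Sum>m\<in>{m \<in> Poly_Mapping.keys f. Poly_Mapping.lookup m y = d}.
           Poly_Mapping.single m (Poly_Mapping.lookup f m))"

definition init_ideal :: "'n \<Rightarrow> ('n, 'k::comm_ring_1) mpol set \<Rightarrow> ('n, 'k) mpol set" where
  "init_ideal y I = ideal_gen (init_form y ` I)"

definition gvd_C :: "'n \<Rightarrow> ('n, 'k::comm_ring_1) mpol set \<Rightarrow> ('n, 'k) mpol set" where
  "gvd_C y I = saturation (init_ideal y I) (var y)"

definition gvd_N :: "'n \<Rightarrow> ('n, 'k::comm_ring_1) mpol set \<Rightarrow> ('n, 'k) mpol set" where
  "gvd_N y I = ideal_gen {f \<in> I. free_of y f}"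

definition geometric_vertex_decomposition ::
    "'n \<Rightarrow> ('n, 'k::comm_ring_1) mpol set \<Rightarrow> bool" where
  "geometric_vertex_decomposition y I \<longleftrightarrow>
     init_ideal y I = gvd_C y I \<inter> (gvd_N y I + ideal_gen {var y}) \<and>
     (ideal_radical (gvd_C y I) = ideal_radical (gvd_N y I) \<or>
      minimal_primes (gvd_C y I) \<inter> minimal_primes (gvd_N y I) = {})"

definition degenerate_gvd :: "'n \<Rightarrow> ('n, 'k::comm_ring_1) mpol set \<Rightarrow> bool" where
  "degenerate_gvd y I \<longleftrightarrow>
     gvd_C y I = UNIV \<or> ideal_radical (gvd_C y I) = ideal_radical (gvd_N y I)"

definition gvd_pair ::
    "'n \<Rightarrow> ('n, 'k::comm_ring_1) mpol set \<Rightarrow> ('n, 'k) mpol \<Rightarrow> ('n, 'k) mpol \<Rightarrow> bool" where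
  "gvd_pair y I q r\<^sub>0 \<longleftrightarrow>
     q \<in> gvd_C y I \<and> var y * q + r\<^sub>0 \<in> I \<and> free_of y q \<and> free_of y r\<^sub>0 \<and>
     nonzerodivisor_mod (gvd_N y I) q \<and> nonzerodivisor_mod (gvd_N y I) (var y * q + r\<^sub>0)"

text \<open>\<open>\<psi>\<close> is the isomorphism \<open>C/N \<rightarrow> I/N\<close> given by multiplication by \<open>(x\<^sub>n q + r\<^sub>0)/q\<close>, for some
  admissible pair \<open>(q, r\<^sub>0)\<close>.\<close>

definition gvd_isomorphism ::
    "'n \<Rightarrow> ('n, 'k::comm_ring_1) mpol set \<Rightarrow>
     (('n, 'k) mpol set \<Rightarrow> ('n, 'k) mpol set) \<Rightarrow> bool" where
  "gvd_isomorphism y I \<psi> \<longleftrightarrow>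
     quotient_module_iso (gvd_C y I) I (gvd_N y I) \<psi> \<and>
     (\<exists>q r\<^sub>0. gvd_pair y I q r\<^sub>0 \<and>
        (\<forall>f\<in>gvd_C y I. \<exists>h\<in>I. f * (var y * q + r\<^sub>0) - h * q \<in> gvd_N y I \<and>
           \<psi> (f +o gvd_N y I) = h +o gvd_N y I))"

end

theory Submission
  imports Defs
begin

text \<open>
  Write \<open>y\<close> for the distinguished variable, \<open>C\<close> and \<open>N\<close> for \<open>gvd_C y I\<close> and \<open>gvd_N y I\<close>, and view a
  polynomial as a univariate polynomial in \<open>y\<close> over the subring of polynomials free of \<open>y\<close>.

  The equality of ideals in a geometric vertex decomposition says that the leading coefficients (with
  respect to \<open>y\<close>) of elements of \<open>I\<close> all occur already in degree one.  So up to \<open>N\<close>, the ideal \<open>I\<close> is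
  generated by elements \<open>y * l + r\<close> with \<open>l\<close> and \<open>r\<close> free of \<open>y\<close>, and the elements \<open>l\<close> generate
  \<open>C\<close>.  The given \<open>u\<close> is free of \<open>y\<close>, because it divides the nonzero polynomial \<open>g\<close>, and it lies in
  \<open>C\<close>; hence there is some \<open>w = y * u + r\<^sub>0\<close> in \<open>I\<close>.  For any other \<open>y * l + r\<close> in \<open>I\<close> the difference
  \<open>l * w - (y * l + r) * u\<close> is free of \<open>y\<close> and in \<open>I\<close>, so in \<open>N\<close>.  Therefore every \<open>f \<in> C\<close> has a partner
  \<open>h \<in> I\<close> with \<open>f * w - h * u \<in> N\<close>, and every \<open>h \<in> I\<close> a partner \<open>f \<in> C\<close> (\<open>fraction_image\<close>,
  \<open>fraction_preimage\<close>).  As \<open>u\<close> and \<open>w\<close> are nonzerodivisors modulo \<open>N\<close>, this correspondence is the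
  isomorphism \<open>\<psi>\<close> (\<open>quotient_module_iso_by_fraction\<close>).  The polynomial ring is noetherian, so every zero
  divisor modulo \<open>N\<close> lies in an associated prime of \<open>N\<close>; this is why \<open>u\<close> is not one, and then \<open>w\<close> is not
  either, having \<open>u\<close> as its leading coefficient.

  Write \<open>g = u * v\<close>.  The polynomial asked for is \<open>F = v * w = y * g + v * r\<^sub>0\<close>.  In \<open>F ^ (p - 1)\<close> only the term
  \<open>(y * g) ^ (p - 1)\<close> has degree \<open>p - 1\<close> in \<open>y\<close>, and the trace of all the others vanishes, so
  \<open>trace p (F ^ (p - 1)) = 1\<close>.  For the compatibility with \<open>I\<close> (\<open>compatibly_split_by_fraction\<close>), let
  \<open>t = trace p (F ^ (p - 1) * h)\<close> with \<open>h \<in> I\<close>, and let \<open>f\<close> be the partner of \<open>h\<close>.  Modulo \<open>N\<close>,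
  \<open>u * t = trace p (u ^ p * F ^ (p - 1) * h) = trace p (g ^ (p - 1) * w ^ (p - 1) * (u * h))\<close>
  is congruent to \<open>trace p (g ^ (p - 1) * w ^ p * f) = w * f'\<close> with \<open>f' = trace p (g ^ (p - 1) * f)\<close>.
  Both the congruence and the membership of \<open>f'\<close> in \<open>C\<close> hold because \<open>a \<mapsto> trace p (g ^ (p - 1) * a)\<close>
  preserves \<open>N\<close> and \<open>C\<close>, which the compatibility of the given splitting implies as \<open>y\<close> is a
  nonzerodivisor modulo both (\<open>compatible_cancel\<close>).  The partner \<open>h' \<in> I\<close> of \<open>f'\<close> thus satisfies
  \<open>u * (t - h') \<in> N\<close>, whence \<open>t \<in> h' + N \<subseteq> I\<close>.
\<close>

section \<open>Ideals of a commutative ring\<close>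

lemma module_times: "module ((*) :: 'r::comm_ring_1 \<Rightarrow> 'r \<Rightarrow> 'r)"
  by unfold_locales (simp_all add: algebra_simps)

lemma is_ideal_iff:
  "is_ideal J \<longleftrightarrow> 0 \<in> J \<and> (\<forall>a\<in>J. \<forall>b\<in>J. a + b \<in> J) \<and> (\<forall>s. \<forall>a\<in>J. s * a \<in> J)"
  by (auto simp: is_ideal_def module.subspace_def[OF module_times])

lemma is_idealI:
  assumes "0 \<in> J" "\<And>a b. a \<in> J \<Longrightarrow> b \<in> J \<Longrightarrow> a + b \<in> J" "\<And>s a. a \<in> J \<Longrightarrow> s * a \<in> J"
  shows "is_ideal J"
  using assms by (auto simp: is_ideal_iff)

lemma ideal_0: "is_ideal J \<Longrightarrow> 0 \<in> J"
  and ideal_add: "is_ideal J \<Longrightarrow> a \<in> J \<Longrightarrow> b \<in> J \<Longrightarrow> a + b \<in> J"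
  and ideal_mult: "is_ideal J \<Longrightarrow> a \<in> J \<Longrightarrow> s * a \<in> J"
  and ideal_mult_right: "is_ideal J \<Longrightarrow> a \<in> J \<Longrightarrow> a * s \<in> J"
  by (auto simp: is_ideal_iff mult.commute[of a])

lemma ideal_minus: "is_ideal J \<Longrightarrow> a \<in> J \<Longrightarrow> - a \<in> J"
  using ideal_mult[of J a "- 1"] by simp

lemma ideal_diff: "is_ideal J \<Longrightarrow> a \<in> J \<Longrightarrow> b \<in> J \<Longrightarrow> a - b \<in> J"
  using ideal_add[of J a "- b"] ideal_minus[of J b] by simp

lemma ideal_sum: "is_ideal J \<Longrightarrow> (\<And>i. i \<in> A \<Longrightarrow> f i \<in> J) \<Longrightarrow> sum f A \<in> J"
  by (induction A rule: infinite_finite_induct) (auto simp: ideal_0 ideal_add)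

lemma is_ideal_ideal_gen: "is_ideal (ideal_gen B)"
  by (simp add: is_ideal_def ideal_gen_def module.subspace_span[OF module_times])

lemma ideal_gen_superset: "B \<subseteq> ideal_gen B"
  by (simp add: ideal_gen_def module.span_superset[OF module_times])

lemma ideal_gen_minimal: "is_ideal J \<Longrightarrow> B \<subseteq> J \<Longrightarrow> ideal_gen B \<subseteq> J"
  by (simp add: is_ideal_def ideal_gen_def module.span_minimal[OF module_times])

lemma is_ideal_saturation:
  assumes J: "is_ideal J"
  shows "is_ideal (saturation J x)"
proof (rule is_idealI)
  show "0 \<in> saturation J x"
    using ideal_0[OF J] by (simp add: saturation_def)
next
  fix a b assume "a \<in> saturation J x" "b \<in> saturation J x"
  then obtain i j where "x ^ i * a \<in> J" "x ^ j * b \<in> J"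
    by (auto simp: saturation_def)
  then have "x ^ j * (x ^ i * a) + x ^ i * (x ^ j * b) \<in> J"
    by (rule ideal_add[OF J ideal_mult[OF J] ideal_mult[OF J]])
  then have "x ^ (i + j) * (a + b) \<in> J"
    by (simp add: power_add algebra_simps)
  then show "a + b \<in> saturation J x"
    by (auto simp: saturation_def)
next
  fix s a assume "a \<in> saturation J x"
  then obtain i where "x ^ i * a \<in> J"
    by (auto simp: saturation_def)
  then have "s * (x ^ i * a) \<in> J"
    using J by (rule ideal_mult[rotated])
  then show "s * a \<in> saturation J x"
    by (auto simp: saturation_def mult.left_commute)
qed


section \<open>The ascending chain condition\<close>

text \<open>The notions are relative to a subring \<open>R\<close>: the polynomial rings in fewer variables, over which the
  Hilbert basis theorem is iterated, are subsets of one type.\<close>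

definition ideal_within :: "'r::comm_ring_1 set \<Rightarrow> 'r set \<Rightarrow> bool" where
  "ideal_within R J \<longleftrightarrow>
     J \<subseteq> R \<and> 0 \<in> J \<and> (\<forall>a\<in>J. \<forall>b\<in>J. a + b \<in> J) \<and> (\<forall>s\<in>R. \<forall>a\<in>J. s * a \<in> J)"

definition noetherian_within :: "'r::comm_ring_1 set \<Rightarrow> bool" where
  "noetherian_within R \<longleftrightarrow>
     (\<forall>J :: nat \<Rightarrow> 'r set. (\<forall>k. ideal_within R (J k)) \<longrightarrow> mono J \<longrightarrow>
        (\<exists>K. \<forall>k\<ge>K. J k = J K))"

definition subring :: "'r::comm_ring_1 set \<Rightarrow> bool" where
  "subring R \<longleftrightarrow> 1 \<in> R \<and> (\<forall>a\<in>R. \<forall>b\<in>R. a - b \<in> R) \<and> (\<forall>a\<in>R. \<forall>b\<in>R. a * b \<in> R)"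

lemma noetherian_withinD:
  assumes "noetherian_within R" "\<And>k :: nat. ideal_within R (J k)" "mono J"
  shows "\<exists>K. \<forall>k\<ge>K. J k = J K"
  using assms(1)[unfolded noetherian_within_def, THEN spec, THEN mp, THEN mp, of J] assms(2,3) by simp

lemma ideal_within_UNIV [simp]: "ideal_within UNIV J \<longleftrightarrow> is_ideal J"
  by (auto simp: ideal_within_def is_ideal_iff)

lemma subring_0: "subring R \<Longrightarrow> 0 \<in> R"
  unfolding subring_def by (metis diff_self)

lemma subring_uminus: "subring R \<Longrightarrow> a \<in> R \<Longrightarrow> - a \<in> R"
  using subring_0[of R] unfolding subring_def by (metis diff_0)

lemma subring_add: "subring R \<Longrightarrow> a \<in> R \<Longrightarrow> b \<in> R \<Longrightarrow> a + b \<in> R"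
  using subring_uminus[of R b] unfolding subring_def by (metis diff_minus_eq_add)

lemma subring_sum: "subring R \<Longrightarrow> (\<And>i. i \<in> A \<Longrightarrow> f i \<in> R) \<Longrightarrow> sum f A \<in> R"
  by (induction A rule: infinite_finite_induct) (auto simp: subring_0 subring_add)

lemma ideal_within_diff:
  assumes R: "subring R" and J: "ideal_within R J" and a: "a \<in> J" and b: "b \<in> J"
  shows "a - b \<in> J"
proof -
  have "- 1 \<in> R"
    using R by (simp add: subring_def subring_uminus)
  then have "(- 1) * b \<in> J"
    using J b by (auto simp: ideal_within_def)
  then have "a + (- 1) * b \<in> J"
    using J a by (auto simp: ideal_within_def)
  then show ?thesis by simp
qed

definition polys_over :: "'r::comm_ring_1 set \<Rightarrow> 'r poly set" where
  "polys_over R = {P. \<forall>i. coeff P i \<in> R}"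

definition lead_coeffs :: "nat \<Rightarrow> 'r::comm_ring_1 poly set \<Rightarrow> 'r set" where
  "lead_coeffs d J = {coeff P d | P. P \<in> J \<and> degree P \<le> d}"

lemma lead_coeffs_mono: "J \<subseteq> J' \<Longrightarrow> lead_coeffs d J \<subseteq> lead_coeffs d J'"
  by (auto simp: lead_coeffs_def)

lemma const_in_polys_over: "subring R \<Longrightarrow> a \<in> R \<Longrightarrow> [:a:] \<in> polys_over R"
  by (auto simp: polys_over_def coeff_pCons subring_0 split: nat.split)

lemma X_in_polys_over: "subring R \<Longrightarrow> [:0, 1:] \<in> polys_over R"
  by (auto simp: polys_over_def coeff_pCons subring_0 subring_def split: nat.split)

lemma lead_coeffs_Suc:
  assumes R: "subring R" and J: "ideal_within (polys_over R) J"
  shows "lead_coeffs d J \<subseteq> lead_coeffs (Suc d) J"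
proof
  fix a assume "a \<in> lead_coeffs d J"
  then obtain P where P: "P \<in> J" "degree P \<le> d" "coeff P d = a"
    by (auto simp: lead_coeffs_def)
  have "[:0, 1:] * P \<in> J"
    using J P X_in_polys_over[OF R] unfolding ideal_within_def by blast
  then have "pCons 0 P \<in> J" by simp
  moreover have "degree (pCons 0 P) \<le> Suc d"
    using P by (meson degree_pCons_le le_trans Suc_le_mono)
  ultimately show "a \<in> lead_coeffs (Suc d) J"
    using P by (force simp: lead_coeffs_def)
qed

lemma lead_coeffs_mono_degree:
  assumes "subring R" "ideal_within (polys_over R) J" "d \<le> e"
  shows "lead_coeffs d J \<subseteq> lead_coeffs e J"
  using assms(3) by (rule lift_Suc_mono_le[of "\<lambda>d. lead_coeffs d J", rotated])
    (rule lead_coeffs_Suc[OF assms(1,2)])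

lemma ideal_within_lead_coeffs:
  assumes R: "subring R" and J: "ideal_within (polys_over R) J"
  shows "ideal_within R (lead_coeffs d J)"
  unfolding ideal_within_def
proof (intro conjI ballI)
  show "lead_coeffs d J \<subseteq> R"
    using J by (auto simp: lead_coeffs_def ideal_within_def polys_over_def)
  show "0 \<in> lead_coeffs d J"
    using J unfolding lead_coeffs_def ideal_within_def by (force intro: exI[of _ 0])
next
  fix a b assume "a \<in> lead_coeffs d J" "b \<in> lead_coeffs d J"
  then obtain P Q where PQ: "P \<in> J" "degree P \<le> d" "coeff P d = a" "Q \<in> J" "degree Q \<le> d" "coeff Q d = b"
    by (auto simp: lead_coeffs_def)
  then have "P + Q \<in> J" "degree (P + Q) \<le> d"
    using J by (auto simp: ideal_within_def degree_add_le)
  with PQ show "a + b \<in> lead_coeffs d J"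
    unfolding lead_coeffs_def by (force intro!: exI[of _ "P + Q"])
next
  fix s a assume s: "s \<in> R" and "a \<in> lead_coeffs d J"
  then obtain P where P: "P \<in> J" "degree P \<le> d" "coeff P d = a"
    by (auto simp: lead_coeffs_def)
  have "[:s:] * P \<in> J"
    using J P const_in_polys_over[OF R s] unfolding ideal_within_def by blast
  moreover have "degree (smult s P) \<le> d"
    using P degree_smult_le le_trans by blast
  ultimately show "s * a \<in> lead_coeffs d J"
    using P unfolding lead_coeffs_def by (force intro!: exI[of _ "smult s P"])
qed

text \<open>Subtracting from an element of the larger ideal an element of the smaller one with the same
  leading coefficient lowers the degree, so the division never leaves the smaller ideal.\<close>

lemma ideal_le_if_lead_coeffs_le:
  assumes R: "subring R" and J: "ideal_within (polys_over R) J" and J': "ideal_within (polys_over R) J'"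
    and "J \<subseteq> J'" and lc: "\<And>d. lead_coeffs d J' \<subseteq> lead_coeffs d J"
  shows "J' \<subseteq> J"
proof -
  have R': "subring (polys_over R)"
    unfolding subring_def
  proof (intro conjI ballI)
    show "1 \<in> polys_over R"
      using R const_in_polys_over[of R 1] by (simp add: subring_def one_pCons)
  next
    fix P Q assume "P \<in> polys_over R" "Q \<in> polys_over R"
    then show "P - Q \<in> polys_over R"
      using R by (auto simp: polys_over_def subring_def)
  next
    fix P Q assume *: "P \<in> polys_over R" "Q \<in> polys_over R"
    then have "coeff P i * coeff Q j \<in> R" for i j
      using R by (auto simp: polys_over_def subring_def)
    then show "P * Q \<in> polys_over R"
      by (auto simp: polys_over_def coeff_mult intro: subring_sum[OF R])
  qed
  have "\<forall>P\<in>J'. (\<forall>i\<ge>n. coeff P i = 0) \<longrightarrow> P \<in> J" for n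
  proof (induction n)
    case 0
    have "0 \<in> J" using J by (simp add: ideal_within_def)
    then show ?case by (auto simp: poly_eq_iff) (metis poly_eqI coeff_0)
  next
    case (Suc n)
    show ?case
    proof (intro ballI impI)
      fix P assume P: "P \<in> J'" "\<forall>i\<ge>Suc n. coeff P i = 0"
      have "degree P \<le> n"
        using P(2) by (intro degree_le) auto
      then have "coeff P n \<in> lead_coeffs n J"
        using P(1) lc[of n] by (auto simp: lead_coeffs_def)
      then obtain Q where Q: "Q \<in> J" "degree Q \<le> n" "coeff Q n = coeff P n"
        by (auto simp: lead_coeffs_def)
      have "P - Q \<in> J'"
        using ideal_within_diff[OF R' J' P(1)] Q(1) \<open>J \<subseteq> J'\<close> by blast
      moreover have "\<forall>i\<ge>n. coeff (P - Q) i = 0"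
      proof (intro allI impI)
        fix i assume "n \<le> i"
        then consider "i = n" | "Suc n \<le> i" "degree Q < i"
          using Q(2) by linarith
        then show "coeff (P - Q) i = 0"
          using P(2) Q(3) by cases (auto simp: coeff_eq_0)
      qed
      ultimately have "P - Q \<in> J"
        using Suc.IH by blast
      then have "(P - Q) + Q \<in> J"
        using Q(1) J unfolding ideal_within_def by blast
      then show "P \<in> J" by simp
    qed
  qed
  then show ?thesis
    by (metis coeff_eq_0 less_eq_Suc_le subsetI)
qed

text \<open>The Hilbert basis theorem for chains.  The diagonal \<open>k \<mapsto> lead_coeffs k (J k)\<close> is
  itself a chain; once it is constant, only finitely many degrees are left, and each of them
  gives one more chain to wait for.\<close>

theorem noetherian_within_polys_over:
  assumes R: "subring R" and noeth: "noetherian_within R"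
  shows "noetherian_within (polys_over R)"
  unfolding noetherian_within_def
proof (intro allI impI)
  fix J :: "nat \<Rightarrow> 'a poly set"
  assume J: "\<forall>k. ideal_within (polys_over R) (J k)" and "mono J"
  have L: "ideal_within R (lead_coeffs d (J k))" for d k
    using J R ideal_within_lead_coeffs by blast
  have le: "lead_coeffs d (J k) \<subseteq> lead_coeffs e (J l)" if "d \<le> e" "k \<le> l" for d e k l
    using lead_coeffs_mono_degree[OF R, of "J k" d e] J lead_coeffs_mono[of "J k" "J l" e]
      monoD[OF \<open>mono J\<close> \<open>k \<le> l\<close>] that by blast
  have "\<exists>K. \<forall>k\<ge>K. lead_coeffs k (J k) = lead_coeffs K (J K)"
    using noeth L le by (intro noetherian_withinD) (auto simp: mono_def)
  then obtain K where K: "\<And>k. k \<ge> K \<Longrightarrow> lead_coeffs k (J k) = lead_coeffs K (J K)"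
    by blast
  have "\<exists>K. \<forall>k\<ge>K. lead_coeffs d (J k) = lead_coeffs d (J K)" for d
    using noeth L le by (intro noetherian_withinD) (auto simp: mono_def)
  then obtain \<kappa> where \<kappa>: "\<And>d k. k \<ge> \<kappa> d \<Longrightarrow> lead_coeffs d (J k) = lead_coeffs d (J (\<kappa> d))"
    by metis
  define M where "M = Max (insert K (\<kappa> ` {..<K}))"
  have M: "K \<le> M" "\<And>d. d < K \<Longrightarrow> \<kappa> d \<le> M"
    by (auto simp: M_def)
  have "J k \<subseteq> J M" if k: "k \<ge> M" for k
  proof (rule ideal_le_if_lead_coeffs_le[OF R])
    show "J M \<subseteq> J k"
      using k \<open>mono J\<close> by (auto dest: monoD)
    fix d
    show "lead_coeffs d (J k) \<subseteq> lead_coeffs d (J M)"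
    proof (cases "d < K")
      case True
      then show ?thesis
        using \<kappa>[of d k] \<kappa>[of d M] M(2)[of d] k by auto
    next
      case False
      have "lead_coeffs d (J k) \<subseteq> lead_coeffs (max d k) (J (max d k))"
        by (rule le) auto
      also have "\<dots> = lead_coeffs K (J K)"
        using False by (intro K) auto
      also have "\<dots> \<subseteq> lead_coeffs d (J M)"
        using False M by (intro le) auto
      finally show ?thesis .
    qed
  qed (use J in auto)
  then show "\<exists>K. \<forall>k\<ge>K. J k = J K"
    using \<open>mono J\<close> by (intro exI[of _ M]) (auto dest: monoD)
qed

text \<open>A maximal one among the proper colon ideals \<open>J : b\<close> that contain \<open>u\<close> is prime: replacing \<open>b\<close> by
  \<open>c * b\<close> cannot enlarge it unless \<open>c * b\<close> falls into \<open>J\<close>.\<close>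

lemma nonzerodivisor_mod_if_not_in_associated_primes:
  fixes J :: "'r::comm_ring_1 set"
  assumes noeth: "noetherian_within (UNIV :: 'r set)" and J: "is_ideal J"
    and u: "u \<notin> \<Union> (associated_primes J)"
  shows "nonzerodivisor_mod J u"
proof (rule ccontr)
  assume "\<not> nonzerodivisor_mod J u"
  then obtain b\<^sub>0 where b\<^sub>0: "u * b\<^sub>0 \<in> J" "b\<^sub>0 \<notin> J"
    by (auto simp: nonzerodivisor_mod_def)
  define colon where "colon b = {a. a * b \<in> J}" for b :: 'r
  define r where "r = {(P :: 'r set, Q). is_ideal P \<and> is_ideal Q \<and> Q \<subset> P}"
  have "wf r"
    unfolding wf_iff_no_infinite_down_chain
  proof
    assume "\<exists>f. \<forall>i. (f (Suc i), f i) \<in> r"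
    then obtain f :: "nat \<Rightarrow> 'r set" where f: "\<And>i. (f (Suc i), f i) \<in> r"
      by blast
    then have f': "is_ideal (f k)" "f k \<subset> f (Suc k)" for k
      unfolding r_def by blast+
    then have "mono f"
      by (intro mono_iff_le_Suc[THEN iffD2]) blast
    then have "\<exists>K. \<forall>k\<ge>K. f k = f K"
      using noeth f'(1) by (intro noetherian_withinD) auto
    then obtain K where K: "\<forall>k\<ge>K. f k = f K" ..
    have "f (Suc K) = f K" by (rule K[rule_format]) simp
    then show False
      using f'(2)[of K] by blast
  qed
  moreover have "colon b\<^sub>0 \<in> {colon b | b. b \<notin> J \<and> u \<in> colon b}"
    using b\<^sub>0 by (auto simp: colon_def)
  ultimately obtain P where "P \<in> {colon b | b. b \<notin> J \<and> u \<in> colon b}"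
    and max: "\<And>Q. (Q, P) \<in> r \<Longrightarrow> Q \<notin> {colon b | b. b \<notin> J \<and> u \<in> colon b}"
    by (rule wfE_min) blast
  then obtain b where b: "P = colon b" "b \<notin> J" "u \<in> colon b"
    by blast
  have ideal: "is_ideal (colon c)" for c
    using J by (intro is_idealI) (auto simp: colon_def distrib_right mult.assoc intro: ideal_0 ideal_add ideal_mult)
  have "prime_ideal P"
    unfolding prime_ideal_def
  proof (intro conjI allI impI)
    show "is_ideal P" using ideal b by simp
    have "1 \<notin> P" using b by (simp add: colon_def)
    then show "P \<noteq> UNIV" by blast
  next
    fix a c assume ac: "a * c \<in> P"
    show "a \<in> P \<or> c \<in> P"
    proof (rule disjCI)
      assume "c \<notin> P"
      then have cb: "c * b \<notin> J" using b by (simp add: colon_def)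
      have sub: "colon b \<subseteq> colon (c * b)"
        using J by (auto simp: colon_def mult.left_commute[of _ c] intro: ideal_mult)
      then have "colon (c * b) \<in> {colon b | b. b \<notin> J \<and> u \<in> colon b}"
        using cb b by blast
      then have "(colon (c * b), P) \<notin> r"
        using max by blast
      then have "colon (c * b) = P"
        using sub ideal b by (auto simp: r_def)
      then show "a \<in> P"
        using ac b by (auto simp: colon_def mult.assoc)
    qed
  qed
  then have "P \<in> associated_primes J"
    using b by (auto simp: associated_primes_def colon_def)
  then show False
    using u b by auto
qed


section \<open>Polynomials as univariate polynomials in one chosen variable\<close>

lemma mpol_eq_sum_monomials:
  "f = (\<Sum>m\<in>Poly_Mapping.keys f. Poly_Mapping.single m (Poly_Mapping.lookup f m))"
  by (rule poly_mapping_eqI)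
    (auto simp: lookup_sum lookup_single when_def sum.delta in_keys_iff intro: sum.neutral)

lemma mpol_induct [case_names zero add single]:
  fixes f :: "('n, 'k::comm_ring_1) mpol"
  assumes "P 0" "\<And>f g. P f \<Longrightarrow> P g \<Longrightarrow> P (f + g)" "\<And>m c. P (Poly_Mapping.single m c)"
  shows "P f"
proof -
  have "P (sum (\<lambda>m. Poly_Mapping.single m (Poly_Mapping.lookup f m)) A)" for A
    using assms by (induction A rule: infinite_finite_induct) auto
  then show ?thesis
    using mpol_eq_sum_monomials[of f] by metis
qed

text \<open>The support of \<open>f + g\<close> can be smaller than the union of the two supports, but all three sums may be
  extended to that union since \<open>G\<close> vanishes on the coefficient zero.\<close>

lemma sum_keys_add:
  fixes f g :: "'a \<Rightarrow>\<^sub>0 'k::ab_group_add"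
  assumes G0: "\<And>m. G m 0 = (0 :: 'b::comm_monoid_add)"
    and G: "\<And>m a b. G m (a + b) = G m a + G m b"
  shows "(\<Sum>m\<in>Poly_Mapping.keys (f + g). G m (Poly_Mapping.lookup (f + g) m)) =
    (\<Sum>m\<in>Poly_Mapping.keys f. G m (Poly_Mapping.lookup f m)) +
    (\<Sum>m\<in>Poly_Mapping.keys g. G m (Poly_Mapping.lookup g m))"
proof -
  let ?A = "Poly_Mapping.keys f \<union> Poly_Mapping.keys g"
  have *: "(\<Sum>m\<in>Poly_Mapping.keys h. G m (Poly_Mapping.lookup h m)) =
      (\<Sum>m\<in>?A. G m (Poly_Mapping.lookup h m))" if "Poly_Mapping.keys h \<subseteq> ?A" for h
    using that by (intro sum.mono_neutral_left) (auto simp: in_keys_iff G0)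
  show ?thesis
    using *[of f] *[of g] *[of "f + g"] keys_add[of f g] by (simp add: lookup_add G sum.distrib)
qed

definition drop_var :: "'n \<Rightarrow> ('n \<Rightarrow>\<^sub>0 nat) \<Rightarrow> ('n \<Rightarrow>\<^sub>0 nat)" where
  "drop_var y m = m - Poly_Mapping.single y (Poly_Mapping.lookup m y)"

text \<open>The coefficients of \<open>in_var y f\<close> stay in the type of polynomials in all the variables, so that \<open>y\<close> itself
  can be substituted: evaluation at \<open>var y\<close> inverts \<open>in_var y\<close>.\<close>

definition in_var :: "'n \<Rightarrow> ('n, 'k::comm_ring_1) mpol \<Rightarrow> ('n, 'k) mpol poly" where
  "in_var y f = (\<Sum>m\<in>Poly_Mapping.keys f.
     monom (Poly_Mapping.single (drop_var y m) (Poly_Mapping.lookup f m)) (Poly_Mapping.lookup m y))"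

lemma lookup_drop_var:
  "Poly_Mapping.lookup (drop_var y m) i = (if i = y then 0 else Poly_Mapping.lookup m i)"
  by (simp add: drop_var_def lookup_minus lookup_single when_def)

lemma keys_drop_var: "Poly_Mapping.keys (drop_var y m) = Poly_Mapping.keys m - {y}"
  by (auto simp: in_keys_iff lookup_drop_var split: if_splits)

lemma drop_var_add: "drop_var y (m + m') = drop_var y m + drop_var y m'"
  by (rule poly_mapping_eqI) (simp add: lookup_drop_var lookup_add)

lemma in_var_0 [simp]: "in_var y 0 = 0"
  by (simp add: in_var_def)

lemma in_var_add [simp]: "in_var y (f + g) = in_var y f + in_var y g"
  unfolding in_var_def by (rule sum_keys_add) (simp_all add: single_add add_monom)

lemma in_var_single:
  "in_var y (Poly_Mapping.single m c) =
     monom (Poly_Mapping.single (drop_var y m) c) (Poly_Mapping.lookup m y)"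
  by (cases "c = 0") (simp_all add: in_var_def)

lemma in_var_mult [simp]: "in_var y (f * g) = in_var y f * in_var y g"
proof (induction f rule: mpol_induct)
  case (single m c)
  show ?case
    by (induction g rule: mpol_induct)
      (simp_all add: mult_single in_var_single mult_monom drop_var_add lookup_add algebra_simps)
qed (simp_all add: algebra_simps)

lemma in_var_uminus [simp]: "in_var y (- f) = - in_var y f"
  using in_var_add[of y f "- f"] by (simp add: eq_neg_iff_add_eq_0 add.commute)

lemma in_var_diff [simp]: "in_var y (f - g) = in_var y f - in_var y g"
  using in_var_add[of y f "- g"] by simp

lemma in_var_1 [simp]: "in_var y 1 = 1"
  using in_var_single[of y 0 1] by (simp add: drop_var_def one_poly_eq_simps)

lemma in_var_power [simp]: "in_var y (f ^ n) = in_var y f ^ n"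
  by (induction n) simp_all

lemma in_var_var [simp]: "in_var y (var y) = [:0, 1:]"
proof -
  have "drop_var y (Poly_Mapping.single y 1) = 0"
    by (rule poly_mapping_eqI) (simp add: lookup_drop_var lookup_single when_def)
  then show ?thesis
    by (simp add: var_def in_var_single monom_altdef)
qed

lemma var_power: "var y ^ n = Poly_Mapping.single (Poly_Mapping.single y n) 1"
  by (induction n) (simp_all add: var_def mult_single flip: single_add)

lemma poly_in_var: "poly (in_var y f) (var y) = f"
proof (induction f rule: mpol_induct)
  case (single m c)
  have "drop_var y m + Poly_Mapping.single y (Poly_Mapping.lookup m y) = m"
    by (rule poly_mapping_eqI) (auto simp: lookup_drop_var lookup_add lookup_single when_def)
  then show ?case
    by (simp add: in_var_single poly_monom var_power mult_single)
qed simp_all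

lemma in_var_eq_iff [simp]: "in_var y f = in_var y g \<longleftrightarrow> f = g"
  by (metis poly_in_var)

lemma mpol_eq_sum_coeffs: "f = (\<Sum>i\<le>degree (in_var y f). coeff (in_var y f) i * var y ^ i)"
  using poly_in_var[of y f] by (simp add: poly_altdef)

lemma in_var_free:
  assumes "free_of y f"
  shows "in_var y f = [:f:]"
proof -
  have "drop_var y m = m" if "m \<in> Poly_Mapping.keys f" for m
    using assms that by (intro poly_mapping_eqI) (auto simp: free_of_def lookup_drop_var)
  then have "in_var y f = (\<Sum>m\<in>Poly_Mapping.keys f. [:Poly_Mapping.single m (Poly_Mapping.lookup f m):])"
    using assms unfolding in_var_def by (intro sum.cong) (auto simp: free_of_def monom_0)
  also have "\<dots> = [:f:]"
    by (subst (4) mpol_eq_sum_monomials) (simp add: poly_eq_iff coeff_sum coeff_pCons split: nat.split)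
  finally show ?thesis .
qed

lemma free_of_0 [simp]: "free_of y 0"
  by (simp add: free_of_def)

lemma free_of_1 [simp]: "free_of y 1"
  by (simp add: free_of_def)

lemma free_of_single: "Poly_Mapping.lookup m y = 0 \<Longrightarrow> free_of y (Poly_Mapping.single m c)"
  by (simp add: free_of_def)

lemma free_of_add: "free_of y f \<Longrightarrow> free_of y g \<Longrightarrow> free_of y (f + g)"
  using keys_add[of f g] by (auto simp: free_of_def)

lemma free_of_mult: "free_of y f \<Longrightarrow> free_of y g \<Longrightarrow> free_of y (f * g)"
  using keys_mult[of f g] by (fastforce simp: free_of_def lookup_add)

lemma free_of_sum: "(\<And>i. i \<in> A \<Longrightarrow> free_of y (f i)) \<Longrightarrow> free_of y (sum f A)"
  by (induction A rule: infinite_finite_induct) (auto simp: free_of_add)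

lemma free_of_coeff_in_var: "free_of y (coeff (in_var y f) d)"
  by (auto simp: in_var_def coeff_sum lookup_drop_var intro!: free_of_sum free_of_single)

lemma free_of_iff: "free_of y f \<longleftrightarrow> degree (in_var y f) = 0"
proof
  assume "degree (in_var y f) = 0"
  then have "in_var y f = [:coeff (in_var y f) 0:]"
    by (metis coeff_pCons_0 degree_eq_zeroE)
  then have "f = coeff (in_var y f) 0"
    using poly_in_var[of y f] by (metis poly_pCons poly_0 mult_zero_right add_0_right)
  then show "free_of y f"
    by (metis free_of_coeff_in_var)
qed (simp add: in_var_free)

lemma free_of_diff:
  fixes f g :: "('n, 'k::comm_ring_1) mpol"
  shows "free_of y f \<Longrightarrow> free_of y g \<Longrightarrow> free_of y (f - g)"
  using degree_diff_le[of "in_var y f" 0 "in_var y g"] by (simp add: free_of_iff)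

text \<open>Degrees in \<open>y\<close> add up because there are no zero divisors.\<close>

lemma free_of_factor:
  fixes f g :: "('n::linorder, 'k::idom) mpol"
  assumes "free_of y (f * g)" "f * g \<noteq> 0"
  shows "free_of y f" "free_of y g"
proof -
  have "in_var y f \<noteq> 0" "in_var y g \<noteq> 0"
    using assms(2) by (metis in_var_0 in_var_eq_iff mult_zero_left mult_zero_right)+
  then have "degree (in_var y f) + degree (in_var y g) = 0"
    using assms(1) by (simp add: free_of_iff degree_mult_eq)
  then show "free_of y f" "free_of y g"
    by (simp_all add: free_of_iff)
qed


section \<open>The polynomial ring is noetherian\<close>

definition polys_in :: "'n set \<Rightarrow> ('n, 'k::zero) mpol set" where
  "polys_in A = {f. \<forall>m\<in>Poly_Mapping.keys f. Poly_Mapping.keys m \<subseteq> A}"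

lemma polys_in_UNIV [simp]: "polys_in UNIV = UNIV"
  by (simp add: polys_in_def)

lemma polys_in_mono: "A \<subseteq> B \<Longrightarrow> polys_in A \<subseteq> polys_in B"
  by (auto simp: polys_in_def)

lemma subring_polys_in: "subring (polys_in A :: ('n, 'k::comm_ring_1) mpol set)"
  unfolding subring_def
proof (intro conjI ballI)
  show "(1 :: ('n, 'k) mpol) \<in> polys_in A"
    by (simp add: polys_in_def)
next
  fix f g :: "('n, 'k) mpol"
  assume *: "f \<in> polys_in A" "g \<in> polys_in A"
  have "Poly_Mapping.keys (f - g) \<subseteq> Poly_Mapping.keys f \<union> Poly_Mapping.keys g"
    by (auto simp: in_keys_iff lookup_minus)
  with * show "f - g \<in> polys_in A"
    by (auto simp: polys_in_def)
  show "f * g \<in> polys_in A"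
    unfolding polys_in_def
  proof (intro CollectI ballI)
    fix m assume "m \<in> Poly_Mapping.keys (f * g)"
    then obtain m1 m2 where "m = m1 + m2" "m1 \<in> Poly_Mapping.keys f" "m2 \<in> Poly_Mapping.keys g"
      using keys_mult[of f g] by blast
    then show "Poly_Mapping.keys m \<subseteq> A"
      using * keys_add[of m1 m2] unfolding polys_in_def by blast
  qed
qed

lemma in_var_in_polys_over:
  assumes "f \<in> polys_in (insert y A)"
  shows "in_var y f \<in> polys_over (polys_in A)"
proof -
  have "Poly_Mapping.single (drop_var y m) (Poly_Mapping.lookup f m) \<in> polys_in A"
    if "m \<in> Poly_Mapping.keys f" for m
    using assms that keys_drop_var[of y m] by (auto simp: polys_in_def)
  then show ?thesis
    using subring_0[OF subring_polys_in[of A]]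
    by (auto simp: polys_over_def in_var_def coeff_sum intro!: subring_sum[OF subring_polys_in])
qed

lemma in_var_poly_var:
  assumes "\<And>i. free_of y (coeff P i)"
  shows "in_var y (poly P (var y)) = P"
  using assms
proof (induction P)
  case (pCons a P)
  have "free_of y a" "\<And>i. free_of y (coeff P i)"
    using pCons.prems[of 0] pCons.prems[of "Suc _"] by simp_all
  then show ?case
    using pCons.IH by (simp add: in_var_free)
qed simp

lemma poly_var_in_polys_in:
  fixes P :: "('n, 'k::comm_ring_1) mpol poly"
  assumes "P \<in> polys_over (polys_in A)"
  shows "poly P (var y) \<in> polys_in (insert y A)"
proof -
  let ?R = "polys_in (insert y A) :: ('n, 'k) mpol set"
  have R: "subring ?R" by (rule subring_polys_in)
  have "var y \<in> ?R"
    by (simp add: polys_in_def var_def)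
  have "(\<forall>i. coeff P i \<in> ?R) \<longrightarrow> poly P (var y) \<in> ?R"
  proof (induction P)
    case 0
    then show ?case using subring_0[OF R] by simp
  next
    case (pCons a P)
    show ?case
    proof
      assume *: "\<forall>i. coeff (pCons a P) i \<in> ?R"
      then have "a \<in> ?R" "\<forall>i. coeff P i \<in> ?R"
        by (metis coeff_pCons_0, metis coeff_pCons_Suc)
      then have "a \<in> ?R" "- (var y * poly P (var y)) \<in> ?R"
        using pCons.IH \<open>var y \<in> ?R\<close> R subring_uminus[OF R] by (auto simp: subring_def)
      then have "a - - (var y * poly P (var y)) \<in> ?R"
        using R unfolding subring_def by blast
      then show "poly (pCons a P) (var y) \<in> ?R" by simp
    qed
  qed
  then show ?thesis
    using assms polys_in_mono[of A "insert y A"] by (auto simp: polys_over_def)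
qed

lemma ideal_within_image_in_var:
  fixes J :: "('n, 'k::comm_ring_1) mpol set"
  assumes J: "ideal_within (polys_in (insert y A)) J" and "y \<notin> A"
  shows "ideal_within (polys_over (polys_in A)) (in_var y ` J)"
  unfolding ideal_within_def
proof (intro conjI ballI)
  show "in_var y ` J \<subseteq> polys_over (polys_in A)"
    using J in_var_in_polys_over by (fastforce simp: ideal_within_def)
  show "0 \<in> in_var y ` J"
    using J by (force simp: ideal_within_def)
next
  fix P Q assume "P \<in> in_var y ` J" "Q \<in> in_var y ` J"
  then obtain f g where "P = in_var y f" "Q = in_var y g" "f + g \<in> J"
    using J by (auto simp: ideal_within_def)
  then show "P + Q \<in> in_var y ` J"
    by (metis in_var_add imageI)
next
  fix P Q :: "('n, 'k) mpol poly" assume P: "P \<in> polys_over (polys_in A)" and "Q \<in> in_var y ` J"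
  then obtain f where f: "f \<in> J" "Q = in_var y f" by blast
  have "free_of y (coeff P i)" for i
    using P \<open>y \<notin> A\<close>
    unfolding polys_over_def polys_in_def free_of_def not_in_keys_iff_lookup_eq_zero[symmetric] by blast
  then have "P = in_var y (poly P (var y))"
    by (simp add: in_var_poly_var)
  moreover have "poly P (var y) * f \<in> J"
    using J f poly_var_in_polys_in[OF P] unfolding ideal_within_def by blast
  ultimately show "P * Q \<in> in_var y ` J"
    using f by (metis in_var_mult imageI)
qed

text \<open>Induction on the set of variables: for \<open>y \<notin> A\<close>, the ring of polynomials in \<open>insert y A\<close> is
  the ring of univariate polynomials over the ring of polynomials in \<open>A\<close>, by way of \<open>in_var y\<close>.\<close>

theorem noetherian_within_polys_in:
  assumes "finite A"
  shows "noetherian_within (polys_in A :: ('n, 'k::field) mpol set)"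
  using assms
proof (induction A)
  case empty
  have const: "\<exists>c. f = Poly_Mapping.single 0 c" if "f \<in> polys_in {}" for f :: "('n, 'k) mpol"
    using that by (intro exI[of _ "Poly_Mapping.lookup f 0"] poly_mapping_eqI)
      (auto simp: polys_in_def lookup_single when_def in_keys_iff)
  have *: "J = polys_in {}" if J: "ideal_within (polys_in {}) J" and "f \<in> J" "f \<noteq> 0"
    for J and f :: "('n, 'k) mpol"
  proof -
    obtain c where c: "f = Poly_Mapping.single 0 c"
      using const J \<open>f \<in> J\<close> by (auto simp: ideal_within_def)
    have "g \<in> J" if g: "g \<in> polys_in {}" for g
    proof -
      obtain d where d: "g = Poly_Mapping.single 0 d"
        using const g by blast
      have "Poly_Mapping.single 0 (d / c) * f \<in> J"
        using J \<open>f \<in> J\<close> by (auto simp: ideal_within_def polys_in_def)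
      then show ?thesis
        using \<open>f \<noteq> 0\<close> by (cases "c = 0") (simp_all add: c d mult_single)
    qed
    then show ?thesis using J by (auto simp: ideal_within_def)
  qed
  show ?case
    unfolding noetherian_within_def
  proof (intro allI impI)
    fix J :: "nat \<Rightarrow> ('n, 'k) mpol set"
    assume J: "\<forall>k. ideal_within (polys_in {}) (J k)" and "mono J"
    show "\<exists>K. \<forall>k\<ge>K. J k = J K"
    proof (cases "\<exists>K f. f \<in> J K \<and> f \<noteq> 0")
      case True
      then obtain K f where "f \<in> J K" "f \<noteq> 0" by blast
      then have "J k = polys_in {}" if "k \<ge> K" for k
        using * J monoD[OF \<open>mono J\<close> that] by blast
      then show ?thesis by (metis order_refl)
    next
      case False
      then have "J k = {0}" for k
        using J by (auto simp: ideal_within_def)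
      then show ?thesis by simp
    qed
  qed
next
  case (insert y A)
  show ?case
    unfolding noetherian_within_def
  proof (intro allI impI)
    fix J :: "nat \<Rightarrow> ('n, 'k) mpol set"
    assume J: "\<forall>k. ideal_within (polys_in (insert y A)) (J k)" and "mono J"
    have "ideal_within (polys_over (polys_in A)) (in_var y ` J k)" for k
      using J \<open>y \<notin> A\<close> by (intro ideal_within_image_in_var) auto
    moreover have "mono (\<lambda>k. in_var y ` J k)"
      using \<open>mono J\<close> by (auto simp: mono_def)
    ultimately have "\<exists>K. \<forall>k\<ge>K. in_var y ` J k = in_var y ` J K"
      by (rule noetherian_withinD[OF noetherian_within_polys_over[OF subring_polys_in insert.IH]])
    moreover have "inj (in_var y :: ('n, 'k) mpol \<Rightarrow> _)"
      by (simp add: inj_def)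
    ultimately show "\<exists>K. \<forall>k\<ge>K. J k = J K"
      by (simp add: inj_image_eq_iff)
  qed
qed

corollary noetherian_mpol: "noetherian_within (UNIV :: ('n::finite, 'k::field) mpol set)"
  using noetherian_within_polys_in[of "UNIV :: 'n set"] by simp


section \<open>The trace map\<close>

lemma char_mpol: "CHAR(('n, 'k::field) mpol) = CHAR('k)"
proof (rule CHAR_eqI)
  show "of_nat CHAR('k) = (0 :: ('n, 'k) mpol)"
    by (simp flip: single_of_nat)
next
  fix n assume "of_nat n = (0 :: ('n, 'k) mpol)"
  then have "of_nat n = (0 :: 'k)"
    by (metis lookup_single_eq lookup_zero single_of_nat)
  then show "CHAR('k) dvd n"
    by (simp add: of_nat_eq_0_iff_char_dvd)
qed

lemma trace_monom_eqI:
  assumes "p > 0" and w: "\<And>i. Poly_Mapping.lookup m i + 1 = p * (Poly_Mapping.lookup w i + 1)"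
  shows "trace_monom p m = Poly_Mapping.single w 1"
proof -
  have "w' = w" if "\<And>i. Poly_Mapping.lookup m i + 1 = p * (Poly_Mapping.lookup w' i + 1)" for w'
    using \<open>p > 0\<close> that w by (intro poly_mapping_eqI) (metis add_right_cancel mult_left_cancel not_gr_zero)
  then have "(THE w. \<forall>i. Poly_Mapping.lookup m i + 1 = p * (Poly_Mapping.lookup w i + 1)) = w"
    using w by (intro the_equality) auto
  moreover have "\<exists>w. \<forall>i. Poly_Mapping.lookup m i + 1 = p * (Poly_Mapping.lookup w i + 1)"
    using w by blast
  ultimately show ?thesis
    by (simp only: trace_monom_def Let_def if_True)
qed

lemma trace_monom_eq_0I:
  assumes "\<And>w. \<exists>i. Poly_Mapping.lookup m i + 1 \<noteq> p * (Poly_Mapping.lookup w i + 1)"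
  shows "trace_monom p m = 0"
  using assms unfolding trace_monom_def Let_def by meson

text \<open>Subtracting \<open>s\<close> from a root \<open>w\<close> of the monomial with exponent \<open>p * s + t\<close> gives a root of the one with
  exponent \<open>t\<close>.  The truncated difference of exponents is the true one: as \<open>t + 1\<close> is positive in
  each variable, \<open>p * s < p * (w + 1)\<close>.\<close>

lemma trace_monom_shift:
  fixes s t m :: "'n \<Rightarrow>\<^sub>0 nat"
  assumes "p > 0" and m: "\<And>i. Poly_Mapping.lookup m i = p * Poly_Mapping.lookup s i + Poly_Mapping.lookup t i"
  shows "(trace_monom p m :: ('n, 'k::field) mpol) = Poly_Mapping.single s 1 * trace_monom p t"
proof (cases "\<exists>w. \<forall>i. Poly_Mapping.lookup t i + 1 = p * (Poly_Mapping.lookup w i + 1)")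
  case True
  then obtain w where w: "\<And>i. Poly_Mapping.lookup t i + 1 = p * (Poly_Mapping.lookup w i + 1)"
    by blast
  have "(trace_monom p m :: ('n, 'k) mpol) = Poly_Mapping.single (s + w) 1"
    using m w \<open>p > 0\<close> by (intro trace_monom_eqI) (simp_all add: lookup_add algebra_simps)
  moreover have "(trace_monom p t :: ('n, 'k) mpol) = Poly_Mapping.single w 1"
    using \<open>p > 0\<close> w by (rule trace_monom_eqI)
  ultimately show ?thesis
    by (simp add: mult_single)
next
  case False
  have "\<exists>i. Poly_Mapping.lookup m i + 1 \<noteq> p * (Poly_Mapping.lookup w i + 1)" for w
  proof (rule ccontr)
    assume "\<not> ?thesis"
    then have w: "p * Poly_Mapping.lookup s i + Poly_Mapping.lookup t i + 1 = p * (Poly_Mapping.lookup w i + 1)" for i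
      using m by simp
    have "Poly_Mapping.lookup t i + 1 = p * (Poly_Mapping.lookup (w - s) i + 1)" for i
    proof -
      have "p * Poly_Mapping.lookup s i < p * (Poly_Mapping.lookup w i + 1)"
        using w[of i] by linarith
      then have "Poly_Mapping.lookup s i \<le> Poly_Mapping.lookup w i"
        by (metis Suc_eq_plus1 less_Suc_eq_le mult_less_cancel1)
      then obtain e where "Poly_Mapping.lookup w i = Poly_Mapping.lookup s i + e"
        by (auto simp: le_iff_add)
      then show ?thesis
        using w[of i] by (simp add: lookup_minus algebra_simps)
    qed
    then show False using False by blast
  qed
  then have "(trace_monom p m :: ('n, 'k) mpol) = 0"
    by (rule trace_monom_eq_0I)
  moreover have "(trace_monom p t :: ('n, 'k) mpol) = 0"
    using False by (intro trace_monom_eq_0I) blast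
  ultimately show ?thesis by simp
qed

lemma trace_0 [simp]: "trace p 0 = 0"
  by (simp add: trace_def)

text \<open>A root needs exponent at least \<open>p - 1\<close> in every variable.\<close>

lemma trace_eq_0:
  fixes f :: "('n, 'k::field) mpol"
  assumes "\<And>m. m \<in> Poly_Mapping.keys f \<Longrightarrow> Poly_Mapping.lookup m y + 1 < p"
  shows "trace p f = 0"
  unfolding trace_def
proof (intro sum.neutral ballI)
  fix m assume m: "m \<in> Poly_Mapping.keys f"
  have "trace_monom p m = (0 :: ('n, 'k) mpol)"
  proof (rule trace_monom_eq_0I)
    fix w
    have "p \<le> p * (Poly_Mapping.lookup w y + 1)" by simp
    then show "\<exists>i. Poly_Mapping.lookup m i + 1 \<noteq> p * (Poly_Mapping.lookup w i + 1)"
      using assms[OF m] by (metis leD)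
  qed
  then show "const (proot p (Poly_Mapping.lookup f m)) * trace_monom p m = 0"
    by simp
qed

lemma single_power:
  "Poly_Mapping.single s c ^ n = Poly_Mapping.single (\<Sum>i<n. s) (c ^ n)"
  by (induction n) (simp_all add: mult_single add.commute)

context
  fixes p :: nat
  assumes prime_p: "prime p" and char_p: "CHAR('k::field) = p"
    and perfect: "surj (\<lambda>c::'k. c ^ p)"
begin

lemma p_pos: "p > 0"
  using prime_p by (rule prime_gt_0_nat)

lemma proot_power: "proot p (c ^ p :: 'k) = c"
  unfolding proot_def
proof (rule the_equality)
  fix d :: 'k assume d: "d ^ p = c ^ p"
  have "((d - c) + c) ^ p = (d - c) ^ p + c ^ p"
    using prime_p char_p by (intro freshmans_dream) simp_all
  then show "d = c" using d p_pos by simp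
qed simp

lemma proot_0: "proot p (0 :: 'k) = 0"
  using proot_power[of 0] p_pos by (simp add: zero_power)

lemma obtain_proot: obtains d :: 'k where "c = d ^ p"
  using perfect by (metis surjE)

lemma proot_add: "proot p (a + b :: 'k) = proot p a + proot p b"
proof -
  obtain c d :: 'k where "a = c ^ p" "b = d ^ p"
    using obtain_proot by metis
  moreover have "(c + d) ^ p = c ^ p + d ^ p"
    using prime_p char_p by (intro freshmans_dream) simp_all
  ultimately show ?thesis
    using proot_power by metis
qed

lemma proot_power_mult: "proot p (c ^ p * a :: 'k) = c * proot p a"
  by (metis obtain_proot power_mult_distrib proot_power)

lemma trace_add: "trace p (f + g :: ('n, 'k) mpol) = trace p f + trace p g"
  unfolding trace_def
  by (rule sum_keys_add) (simp_all add: proot_0 proot_add const_def single_add algebra_simps)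

lemma trace_single:
  "trace p (Poly_Mapping.single m c :: ('n, 'k) mpol) = Poly_Mapping.single 0 (proot p c) * trace_monom p m"
  by (cases "c = 0") (simp_all add: trace_def const_def proot_0)

lemma trace_power_mult: "trace p (f ^ p * g :: ('n, 'k) mpol) = f * trace p g"
proof (induction f rule: mpol_induct)
  case zero
  then show ?case using p_pos by (simp add: zero_power)
next
  case (add f1 f2)
  have "(f1 + f2) ^ p = f1 ^ p + f2 ^ p"
    using prime_p char_p by (intro freshmans_dream) (simp_all add: char_mpol)
  then show ?case
    using add by (simp add: trace_add algebra_simps)
next
  case (single s c)
  show ?case
  proof (induction g rule: mpol_induct)
    case (single t d)
    have "trace p (Poly_Mapping.single s c ^ p * Poly_Mapping.single t d) =
        trace p (Poly_Mapping.single ((\<Sum>i<p. s) + t) (c ^ p * d))"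
      by (simp add: single_power mult_single)
    also have "\<dots> = Poly_Mapping.single 0 (c * proot p d) * (Poly_Mapping.single s 1 * trace_monom p t)"
      using p_pos by (simp add: trace_single proot_power_mult trace_monom_shift lookup_add lookup_sum)
    also have "\<dots> = (Poly_Mapping.single 0 (c * proot p d) * Poly_Mapping.single s 1) * trace_monom p t"
      by (simp only: mult.assoc)
    also have "Poly_Mapping.single 0 (c * proot p d) * Poly_Mapping.single s 1 =
        Poly_Mapping.single s c * Poly_Mapping.single 0 (proot p d)"
      by (simp add: mult_single)
    finally show ?case
      by (simp only: trace_single mult.assoc)
  qed (simp_all add: trace_add algebra_simps)
qed

lemma trace_sum: "trace p (sum f A :: ('n, 'k) mpol) = (\<Sum>i\<in>A. trace p (f i))"
  by (induction A rule: infinite_finite_induct) (simp_all add: trace_add)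

text \<open>Every term of the binomial expansion except \<open>(y * g) ^ (p - 1)\<close> has degree less than \<open>p - 1\<close>
  in \<open>y\<close>.\<close>

lemma trace_power_add_free:
  fixes g r :: "('n, 'k) mpol"
  assumes g: "free_of y g" and r: "free_of y r"
  shows "trace p ((var y * g + r) ^ (p - 1)) = trace p ((var y * g) ^ (p - 1))"
proof -
  let ?t = "\<lambda>k. of_nat (p - 1 choose k) * (var y * g) ^ k * r ^ (p - 1 - k) :: ('n, 'k) mpol"
  have pow: "free_of y (f ^ k)" if "free_of y f" for f :: "('n, 'k) mpol" and k
    using that by (induction k) (auto simp: free_of_mult free_of_1)
  have zero: "trace p (?t k) = 0" if k: "k < p - 1" for k
  proof (rule trace_eq_0)
    fix m assume m: "m \<in> Poly_Mapping.keys (?t k)"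
    define h where "h = of_nat (p - 1 choose k) * g ^ k * r ^ (p - 1 - k)"
    have "free_of y h"
      unfolding h_def using g r
      by (intro free_of_mult pow) (auto simp: free_of_def simp flip: single_of_nat)
    moreover have "?t k = Poly_Mapping.single (Poly_Mapping.single y k) 1 * h"
      by (simp add: h_def power_mult_distrib var_power ac_simps)
    then obtain m' where "m' \<in> Poly_Mapping.keys h" "m = Poly_Mapping.single y k + m'"
      using m keys_mult[of "Poly_Mapping.single (Poly_Mapping.single y k) 1" h] by auto
    ultimately show "Poly_Mapping.lookup m y + 1 < p"
      using k by (auto simp: free_of_def lookup_add)
  qed
  have "trace p ((var y * g + r) ^ (p - 1)) = (\<Sum>k\<le>p - 1. trace p (?t k))"
    by (simp add: binomial_ring trace_sum)
  also have "\<dots> = (\<Sum>k\<in>{p - 1}. trace p (?t k))"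
    using zero by (intro sum.mono_neutral_right) auto
  finally show ?thesis by simp
qed

end


section \<open>Multiplication by a fraction as an isomorphism of quotients\<close>

lemma coset_eq_iff:
  assumes "is_ideal N"
  shows "a +o N = b +o N \<longleftrightarrow> a - b \<in> N"
proof
  assume "a +o N = b +o N"
  moreover have "a \<in> a +o N"
    using ideal_0[OF assms] by (force simp: elt_set_plus_def)
  ultimately show "a - b \<in> N"
    by (simp add: set_minus_plus)
next
  assume "a - b \<in> N"
  then have "x - b \<in> N \<longleftrightarrow> x - a \<in> N" for x
    using ideal_add[OF assms, of "x - a" "a - b"] ideal_diff[OF assms, of "x - b" "a - b"] by auto
  then show "a +o N = b +o N"
    by (auto simp: set_minus_plus)
qed

lemma coset_add:
  assumes "is_ideal N"
  shows "(a +o N) + (b +o N) = (a + b) +o N"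
proof -
  have "N + N = N"
    using ideal_0[OF assms] ideal_add[OF assms] by (force simp: set_plus_def)
  then show ?thesis by (simp add: set_plus_rearrange)
qed

lemma coset_scale_coset:
  assumes "is_ideal N"
  shows "coset_scale N s (a +o N) = (s * a) +o N"
proof -
  have "0 \<in> s *o N"
    using ideal_0[OF assms] by (force simp: elt_set_times_def)
  moreover have "s *o N \<subseteq> N"
    using ideal_mult[OF assms] by (auto simp: elt_set_times_def)
  moreover have "N + N \<subseteq> N"
    using ideal_add[OF assms] by (auto simp: set_plus_def)
  ultimately have "s *o N + N = N"
    using set_zero_plus2 set_plus_mono2[OF _ order_refl] by (metis subset_antisym subset_trans)
  then show ?thesis
    by (simp only: coset_scale_def set_times_plus_distrib set_plus_rearrange3)
qed

lemma nonzerodivisor_mod_iff: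
  "is_ideal N \<Longrightarrow> nonzerodivisor_mod N a \<Longrightarrow> a * b \<in> N \<longleftrightarrow> b \<in> N"
  unfolding nonzerodivisor_mod_def using ideal_mult by blast

text \<open>Multiplication by \<open>w / u\<close>: for nonzerodivisors \<open>u\<close> and \<open>w\<close> modulo \<open>N\<close>, the relation
  \<open>f * w - h * u \<in> N\<close> determines the class of either element from the class of the other.\<close>

lemma quotient_module_iso_by_fraction:
  fixes C I N :: "'r::comm_ring_1 set"
  assumes C: "is_ideal C" and I: "is_ideal I" and N: "is_ideal N"
    and u: "nonzerodivisor_mod N u" and w: "nonzerodivisor_mod N w"
    and image: "\<And>f. f \<in> C \<Longrightarrow> \<exists>h\<in>I. f * w - h * u \<in> N"
    and preimage: "\<And>h. h \<in> I \<Longrightarrow> \<exists>f\<in>C. f * w - h * u \<in> N"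
  shows "\<exists>\<psi>. quotient_module_iso C I N \<psi> \<and>
    (\<forall>f\<in>C. \<exists>h\<in>I. f * w - h * u \<in> N \<and> \<psi> (f +o N) = h +o N)"
proof -
  define rel where "rel f h \<longleftrightarrow> f \<in> C \<and> h \<in> I \<and> f * w - h * u \<in> N" for f h
  have rel_iff: "f - f' \<in> N \<longleftrightarrow> h - h' \<in> N" if "rel f h" "rel f' h'" for f f' h h'
  proof -
    have d: "(f - f') * w - (h - h') * u \<in> N"
    proof -
      have "(f - f') * w - (h - h') * u = (f * w - h * u) - (f' * w - h' * u)"
        by (simp add: algebra_simps)
      then show ?thesis using that ideal_diff[OF N] by (simp add: rel_def)
    qed
    have "f - f' \<in> N \<longleftrightarrow> w * (f - f') \<in> N"
      by (simp only: nonzerodivisor_mod_iff[OF N w])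
    also have "\<dots> \<longleftrightarrow> u * (h - h') \<in> N"
      using ideal_diff[OF N _ d, of "w * (f - f')"] ideal_add[OF N d, of "u * (h - h')"]
      by (auto simp: mult.commute)
    also have "\<dots> \<longleftrightarrow> h - h' \<in> N"
      by (simp only: nonzerodivisor_mod_iff[OF N u])
    finally show ?thesis .
  qed
  define \<psi> where "\<psi> X = (SOME h. \<exists>f. X = f +o N \<and> rel f h) +o N" for X
  have \<psi>: "\<psi> (f +o N) = h +o N" if "rel f h" for f h
  proof -
    have "\<exists>h' f'. f +o N = f' +o N \<and> rel f' h'"
      using that by blast
    then have "\<exists>f'. f +o N = f' +o N \<and> rel f' (SOME h. \<exists>f'. f +o N = f' +o N \<and> rel f' h)"
      by (rule someI_ex)
    then obtain f' where f': "f +o N = f' +o N" "rel f' (SOME h. \<exists>f'. f +o N = f' +o N \<and> rel f' h)"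
      by blast
    then have "f' - f \<in> N"
      using coset_eq_iff[OF N, of f' f] by simp
    then show ?thesis
      unfolding \<psi>_def using rel_iff[OF f'(2) that] by (simp only: coset_eq_iff[OF N])
  qed
  have rel_to: "\<exists>h. rel f h" if "f \<in> C" for f
    using image[OF that] that by (auto simp: rel_def)
  have rel_back: "\<exists>f. rel f h" if "h \<in> I" for h
    using preimage[OF that] that by (auto simp: rel_def)
  have "quotient_module_iso C I N \<psi>"
    unfolding quotient_module_iso_def
  proof (intro conjI ballI allI)
    show "bij_betw \<psi> (quotient_by C N) (quotient_by I N)"
    proof (rule bij_betw_imageI)
      show "inj_on \<psi> (quotient_by C N)"
      proof (rule inj_onI)
        fix X Y assume "X \<in> quotient_by C N" "Y \<in> quotient_by C N" and eq: "\<psi> X = \<psi> Y"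
        then obtain f f' where f: "X = f +o N" "Y = f' +o N" "f \<in> C" "f' \<in> C"
          by (auto simp: quotient_by_def)
        then obtain h h' where "rel f h" "rel f' h'"
          using rel_to by blast
        then show "X = Y"
          using eq f rel_iff \<psi> coset_eq_iff[OF N] by metis
      qed
      show "\<psi> ` quotient_by C N = quotient_by I N"
      proof (intro equalityI subsetI)
        fix Y assume "Y \<in> \<psi> ` quotient_by C N"
        then obtain f where "f \<in> C" "Y = \<psi> (f +o N)"
          by (auto simp: quotient_by_def)
        moreover obtain h where "rel f h"
          using rel_to \<open>f \<in> C\<close> by blast
        ultimately show "Y \<in> quotient_by I N"
          using \<psi> by (auto simp: quotient_by_def rel_def)
      next
        fix Y assume "Y \<in> quotient_by I N"
        then obtain h where "h \<in> I" "Y = h +o N"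
          by (auto simp: quotient_by_def)
        moreover obtain f where "rel f h"
          using rel_back \<open>h \<in> I\<close> by blast
        ultimately have "Y = \<psi> (f +o N)" "f \<in> C"
          using \<psi> by (auto simp: rel_def)
        then show "Y \<in> \<psi> ` quotient_by C N"
          by (auto simp: quotient_by_def)
      qed
    qed
  next
    fix X Y assume "X \<in> quotient_by C N" "Y \<in> quotient_by C N"
    then obtain f f' where f: "X = f +o N" "Y = f' +o N" "f \<in> C" "f' \<in> C"
      by (auto simp: quotient_by_def)
    then obtain h h' where h: "rel f h" "rel f' h'"
      using rel_to by blast
    then have "rel (f + f') (h + h')"
      using ideal_add[OF C] ideal_add[OF I] ideal_add[OF N, of "f * w - h * u" "f' * w - h' * u"]
      by (auto simp: rel_def algebra_simps)
    then show "\<psi> (X + Y) = \<psi> X + \<psi> Y"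
      using h \<psi> by (simp add: f coset_add[OF N])
  next
    fix s X assume "X \<in> quotient_by C N"
    then obtain f where f: "X = f +o N" "f \<in> C"
      by (auto simp: quotient_by_def)
    then obtain h where h: "rel f h"
      using rel_to by blast
    then have "rel (s * f) (s * h)"
      using ideal_mult[OF C] ideal_mult[OF I] ideal_mult[OF N, of "f * w - h * u" s]
      by (auto simp: rel_def algebra_simps)
    then show "\<psi> (coset_scale N s X) = coset_scale N s (\<psi> X)"
      using h \<psi> by (simp add: f coset_scale_coset[OF N])
  qed
  moreover have "\<forall>f\<in>C. \<exists>h\<in>I. f * w - h * u \<in> N \<and> \<psi> (f +o N) = h +o N"
    using rel_to \<psi> unfolding rel_def by blast
  ultimately show ?thesis by blast
qed


section \<open>Compatible splitting of the third ideal\<close>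

text \<open>Cancelling the nonzerodivisor \<open>x\<close>: the \<open>p\<close>-linearity turns \<open>x * T (g ^ (p - 1) * a)\<close> into
  \<open>T ((x * g) ^ (p - 1) * (x * a))\<close>.\<close>

lemma compatible_cancel:
  fixes T :: "'r::comm_ring_1 \<Rightarrow> 'r"
  assumes p: "p > 0" and linear: "\<And>a b. T (a ^ p * b) = a * T b"
    and J: "is_ideal J" and x: "nonzerodivisor_mod J x"
    and split: "compatibly_split (\<lambda>a. T ((x * g) ^ (p - 1) * a)) J"
    and a: "a \<in> J"
  shows "T (g ^ (p - 1) * a) \<in> J"
proof -
  have "x ^ p = x ^ (p - 1) * x"
    using p by (metis power_minus_mult)
  then have "x ^ p * (g ^ (p - 1) * a) = (x * g) ^ (p - 1) * (x * a)"
    by (simp add: power_mult_distrib ac_simps)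
  then have "x * T (g ^ (p - 1) * a) = T ((x * g) ^ (p - 1) * (x * a))"
    using linear by metis
  also have "\<dots> \<in> J"
    using split ideal_mult[OF J a] by (auto simp: compatibly_split_def)
  finally show ?thesis
    using x by (simp add: nonzerodivisor_mod_def)
qed

text \<open>If \<open>f\<close> and \<open>h\<close> correspond by \<open>w / u\<close>, then so do \<open>T (g ^ (p - 1) * f)\<close> and \<open>T ((v * w) ^ (p - 1) * h)\<close>
  for \<open>g = u * v\<close>, by \<open>p\<close>-linearity; and the first of these stays in \<open>C\<close>.\<close>

lemma compatibly_split_by_fraction:
  fixes T :: "'r::comm_ring_1 \<Rightarrow> 'r"
  assumes p: "p > 0" and linear: "\<And>a b. T (a ^ p * b) = a * T b" and add: "\<And>a b. T (a + b) = T a + T b"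
    and C: "is_ideal C" and I: "is_ideal I" and N: "is_ideal N" and "N \<subseteq> I"
    and xC: "nonzerodivisor_mod C x" and xN: "nonzerodivisor_mod N x" and u: "nonzerodivisor_mod N u"
    and image: "\<And>f. f \<in> C \<Longrightarrow> \<exists>h\<in>I. f * w - h * u \<in> N"
    and preimage: "\<And>h. h \<in> I \<Longrightarrow> \<exists>f\<in>C. f * w - h * u \<in> N"
    and splitC: "compatibly_split (\<lambda>a. T ((x * (u * v)) ^ (p - 1) * a)) C"
    and splitN: "compatibly_split (\<lambda>a. T ((x * (u * v)) ^ (p - 1) * a)) N"
  shows "compatibly_split (\<lambda>a. T ((v * w) ^ (p - 1) * a)) I"
  unfolding compatibly_split_def
proof (intro image_subsetI)
  fix h assume "h \<in> I"
  then obtain f where f: "f \<in> C" "f * w - h * u \<in> N"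
    using preimage by blast
  define g where "g = u * v"
  define n where "n = f * w - h * u"
  define t where "t = T ((v * w) ^ (p - 1) * h)"
  define f' where "f' = T (g ^ (p - 1) * f)"
  define n' where "n' = T (g ^ (p - 1) * (w ^ (p - 1) * n))"
  have f': "f' \<in> C"
    unfolding f'_def g_def by (rule compatible_cancel[OF p linear C xC splitC f(1)])
  have n': "n' \<in> N"
    unfolding n'_def g_def n_def
    by (rule compatible_cancel[OF p linear N xN splitN ideal_mult[OF N f(2)]])
  have T_diff: "T (a - b) = T a - T b" for a b
    using add[of "a - b" b] by simp
  \<comment> \<open>The factor \<open>u ^ p\<close> turns \<open>v ^ (p - 1)\<close> into \<open>g ^ (p - 1)\<close> and leaves \<open>u * h\<close>, which is
    \<open>f * w\<close> up to \<open>N\<close>; this completes \<open>w ^ (p - 1)\<close> to \<open>w ^ p\<close>.\<close>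
  have pow: "c ^ p = c ^ (p - 1) * c" for c :: 'r
    using p by (metis power_minus_mult)
  have "u ^ p * ((v * w) ^ (p - 1) * h) = g ^ (p - 1) * w ^ (p - 1) * (h * u)"
    by (simp add: g_def pow power_mult_distrib ac_simps)
  also have "h * u = f * w - n"
    by (simp add: n_def)
  also have "g ^ (p - 1) * w ^ (p - 1) * (f * w - n) =
      w ^ p * (g ^ (p - 1) * f) - g ^ (p - 1) * (w ^ (p - 1) * n)"
    by (simp add: pow algebra_simps)
  finally have "T (u ^ p * ((v * w) ^ (p - 1) * h)) = w * f' - n'"
    by (simp add: T_diff linear f'_def n'_def)
  then have t: "u * t = w * f' - n'"
    by (simp add: linear t_def)
  obtain h' where h': "h' \<in> I" "f' * w - h' * u \<in> N"
    using image[OF f'] by blast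
  have "u * (t - h') = (f' * w - h' * u) - n'"
    using t by (simp add: algebra_simps)
  then have "u * (t - h') \<in> N"
    using ideal_diff[OF N h'(2) n'] by simp
  then have "t - h' \<in> I"
    using u \<open>N \<subseteq> I\<close> by (auto simp: nonzerodivisor_mod_def)
  then have "(t - h') + h' \<in> I"
    using h'(1) by (rule ideal_add[OF I])
  then show "T ((v * w) ^ (p - 1) * h) \<in> I"
    by (simp add: t_def)
qed


section \<open>Geometric vertex decompositions in terms of leading coefficients\<close>

lemma lookup_coeff_in_var:
  "Poly_Mapping.lookup (coeff (in_var y f) d) m =
     (if Poly_Mapping.lookup m y = 0 then Poly_Mapping.lookup f (m + Poly_Mapping.single y d) else 0)"
proof (induction f rule: mpol_induct)
  case (single m\<^sub>0 c)
  have "Poly_Mapping.lookup m\<^sub>0 y = d \<and> drop_var y m\<^sub>0 = m \<longleftrightarrow>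
      Poly_Mapping.lookup m y = 0 \<and> m\<^sub>0 = m + Poly_Mapping.single y d"
    by (auto simp: poly_mapping_eq_iff fun_eq_iff lookup_drop_var lookup_add lookup_single when_def split: if_splits)
  then show ?case
    by (auto simp: in_var_single lookup_single when_def)
qed (simp_all add: lookup_add)

text \<open>The maximal exponent of \<open>y\<close> in \<open>f\<close> is the degree of \<open>in_var y f\<close>, as distinct monomials with this
  exponent cannot cancel.  For \<open>f = 0\<close> both sides are zero.\<close>

lemma in_var_init_form:
  "in_var y (init_form y f) = monom (lead_coeff (in_var y f)) (degree (in_var y f))"
proof (cases "f = 0")
  case True
  then show ?thesis by (simp add: init_form_def)
next
  case False
  define D where "D = Max ((\<lambda>m. Poly_Mapping.lookup m y) ` Poly_Mapping.keys f)"
  have keys: "Poly_Mapping.keys f \<noteq> {}"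
    using False by simp
  have le: "Poly_Mapping.lookup m y \<le> D" if "Poly_Mapping.lookup f m \<noteq> 0" for m
    unfolding D_def using that by (intro Max_ge) (auto simp: in_keys_iff)
  have "D \<in> (\<lambda>m. Poly_Mapping.lookup m y) ` Poly_Mapping.keys f"
    unfolding D_def using keys by (intro Max_in) auto
  then obtain m where m: "Poly_Mapping.lookup f m \<noteq> 0" "Poly_Mapping.lookup m y = D"
    by (auto simp: in_keys_iff)
  have "degree (in_var y f) = D"
  proof (rule antisym)
    show "degree (in_var y f) \<le> D"
    proof (rule degree_le, intro allI impI)
      fix e assume "D < e"
      then show "coeff (in_var y f) e = 0"
        by (intro poly_mapping_eqI) (use le in \<open>fastforce simp: lookup_coeff_in_var lookup_add\<close>)
    qed
    have "drop_var y m + Poly_Mapping.single y D = m"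
      using m(2) by (intro poly_mapping_eqI) (auto simp: lookup_drop_var lookup_add lookup_single when_def)
    then have "Poly_Mapping.lookup (coeff (in_var y f) D) (drop_var y m) \<noteq> 0"
      using m(1) by (simp add: lookup_coeff_in_var lookup_drop_var)
    then show "D \<le> degree (in_var y f)"
      by (metis le_degree lookup_zero)
  qed
  moreover have "Poly_Mapping.lookup (init_form y f) m = (if Poly_Mapping.lookup m y = D then Poly_Mapping.lookup f m else 0)" for m
    by (auto simp: init_form_def Let_def lookup_sum lookup_single when_def sum.delta in_keys_iff D_def[symmetric])
  ultimately show ?thesis
    by (intro poly_eqI poly_mapping_eqI) (simp add: lookup_coeff_in_var lookup_add)
qed

lemma polys_in_Compl: "f \<in> polys_in (- {y}) \<longleftrightarrow> free_of y f"
proof -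
  have "Poly_Mapping.keys m \<subseteq> - {y} \<longleftrightarrow> Poly_Mapping.lookup m y = 0" for m :: "'a \<Rightarrow>\<^sub>0 nat"
    by (auto simp: in_keys_iff)
  then show ?thesis by (simp add: polys_in_def free_of_def)
qed

lemma nonzerodivisor_mod_saturation: "nonzerodivisor_mod (saturation J x) x"
  unfolding nonzerodivisor_mod_def
proof (intro allI impI)
  fix b assume "x * b \<in> saturation J x"
  then obtain k where "x ^ k * (x * b) \<in> J"
    by (auto simp: saturation_def)
  then have "x ^ Suc k * b \<in> J"
    by (simp add: ac_simps)
  then show "b \<in> saturation J x"
    unfolding saturation_def by blast
qed

text \<open>The growth of \<open>J\<close> matters for products: the coefficient of \<open>s * f\<close> in degree \<open>d\<close> involves those of \<open>f\<close>
  in all the degrees up to \<open>d\<close>.\<close>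

lemma is_ideal_coeffs:
  fixes J :: "nat \<Rightarrow> ('n, 'k::comm_ring_1) mpol set"
  assumes J: "\<And>d. ideal_within (polys_in (- {y})) (J d)" and "\<And>d e. d \<le> e \<Longrightarrow> J d \<subseteq> J e"
  shows "is_ideal {f. \<forall>d. coeff (in_var y f) d \<in> J d}"
proof (rule is_idealI)
  show "0 \<in> {f. \<forall>d. coeff (in_var y f) d \<in> J d}"
    using J by (simp add: ideal_within_def)
next
  fix f g assume "f \<in> {f. \<forall>d. coeff (in_var y f) d \<in> J d}" "g \<in> {f. \<forall>d. coeff (in_var y f) d \<in> J d}"
  then show "f + g \<in> {f. \<forall>d. coeff (in_var y f) d \<in> J d}"
    using J by (simp add: ideal_within_def)
next
  fix s f assume f: "f \<in> {f. \<forall>d. coeff (in_var y f) d \<in> J d}"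
  have "coeff (in_var y s * in_var y f) d \<in> J d" for d
  proof -
    have sum: "sum t A \<in> J d" if "\<And>i. i \<in> A \<Longrightarrow> t i \<in> J d" for t and A :: "nat set"
      using that J[of d] by (induction A rule: infinite_finite_induct) (auto simp: ideal_within_def)
    have "coeff (in_var y f) (d - i) \<in> J d" for i
      using f assms(2)[of "d - i" d] by auto
    moreover have "coeff (in_var y s) i \<in> polys_in (- {y})" for i
      by (simp add: polys_in_Compl free_of_coeff_in_var)
    ultimately have "coeff (in_var y s) i * coeff (in_var y f) (d - i) \<in> J d" for i
      using J[of d] by (simp add: ideal_within_def)
    then show ?thesis
      unfolding coeff_mult by (intro sum)
  qed
  then show "s * f \<in> {f. \<forall>d. coeff (in_var y f) d \<in> J d}"
    by simp
qed

lemma mem_ideal_if_coeffs: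
  assumes "is_ideal J" "\<And>d. coeff (in_var y f) d \<in> J"
  shows "f \<in> J"
  by (subst mpol_eq_sum_coeffs[of f y]) (intro ideal_sum ideal_mult_right assms)

locale vertex_decomposition =
  fixes y :: 'n and I :: "('n, 'k::comm_ring_1) mpol set"
  assumes I: "is_ideal I"
    and init_eq: "init_ideal y I = gvd_C y I \<inter> (gvd_N y I + ideal_gen {var y})"
begin

definition leading :: "nat \<Rightarrow> ('n, 'k) mpol set" where
  "leading d = lead_coeffs d (in_var y ` I)"

lemma ideal_in_var_I: "ideal_within (polys_over (polys_in (- {y}))) (in_var y ` I)"
proof (rule ideal_within_image_in_var)
  have "insert y (- {y}) = UNIV" by auto
  then show "ideal_within (polys_in (insert y (- {y}))) I"
    using I by simp
qed simp

lemma ideal_within_leading: "ideal_within (polys_in (- {y})) (leading d)"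
  unfolding leading_def by (rule ideal_within_lead_coeffs[OF subring_polys_in ideal_in_var_I])

lemma leading_mono: "d \<le> e \<Longrightarrow> leading d \<subseteq> leading e"
  unfolding leading_def by (rule lead_coeffs_mono_degree[OF subring_polys_in ideal_in_var_I])

lemma leading_free: "l \<in> leading d \<Longrightarrow> free_of y l"
  using ideal_within_leading[of d] by (auto simp: ideal_within_def simp flip: polys_in_Compl)

lemma is_ideal_init: "is_ideal (init_ideal y I)"
  by (simp add: init_ideal_def is_ideal_ideal_gen)

lemma is_ideal_C: "is_ideal (gvd_C y I)"
  unfolding gvd_C_def by (rule is_ideal_saturation[OF is_ideal_init])

lemma is_ideal_N: "is_ideal (gvd_N y I)"
  by (simp add: gvd_N_def is_ideal_ideal_gen)

lemma N_subset_I: "gvd_N y I \<subseteq> I"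
  unfolding gvd_N_def using I by (intro ideal_gen_minimal) auto

lemma free_in_N: "f \<in> I \<Longrightarrow> free_of y f \<Longrightarrow> f \<in> gvd_N y I"
  unfolding gvd_N_def by (rule subsetD[OF ideal_gen_superset]) simp

lemma coeff_init_ideal:
  assumes "f \<in> init_ideal y I"
  shows "coeff (in_var y f) d \<in> leading d"
proof -
  have "init_form y ` I \<subseteq> {f. \<forall>d. coeff (in_var y f) d \<in> leading d}"
    using ideal_within_leading by (auto simp: in_var_init_form ideal_within_def) (auto simp: leading_def lead_coeffs_def)
  then have "init_ideal y I \<subseteq> {f. \<forall>d. coeff (in_var y f) d \<in> leading d}"
    unfolding init_ideal_def
    by (intro ideal_gen_minimal is_ideal_coeffs ideal_within_leading leading_mono)
  then show ?thesis using assms by blast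
qed

lemma in_var_var_power_mult: "free_of y l \<Longrightarrow> in_var y (var y ^ d * l) = monom l d"
  by (simp add: in_var_free monom_altdef)

lemma init_ideal_if_leading:
  assumes "l \<in> leading d"
  shows "var y ^ d * l \<in> init_ideal y I"
proof (cases "l = 0")
  case True
  then show ?thesis using ideal_0[OF is_ideal_init] by simp
next
  case False
  obtain h where h: "h \<in> I" "degree (in_var y h) \<le> d" "coeff (in_var y h) d = l"
    using assms by (auto simp: leading_def lead_coeffs_def)
  then have "degree (in_var y h) = d"
    using False by (metis le_antisym le_degree)
  then have "in_var y (init_form y h) = in_var y (var y ^ d * l)"
    using h leading_free[OF assms] by (simp only: in_var_init_form in_var_var_power_mult)
  then have "init_form y h = var y ^ d * l"
    by (simp only: in_var_eq_iff)
  then show ?thesis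
    using h(1) ideal_gen_superset[of "init_form y ` I"] by (force simp: init_ideal_def)
qed

lemma leading_subset_C: "leading d \<subseteq> gvd_C y I"
  using init_ideal_if_leading by (auto simp: gvd_C_def saturation_def)

text \<open>This is what the equality of ideals in the decomposition amounts to: one power of \<open>y\<close> suffices
  in the saturation.\<close>

lemma var_mult_C:
  assumes "f \<in> gvd_C y I"
  shows "var y * f \<in> init_ideal y I"
proof -
  have "var y * f \<in> gvd_C y I"
    using assms by (rule ideal_mult[OF is_ideal_C])
  moreover have "f * var y \<in> ideal_gen {var y}"
    using ideal_gen_superset by (intro ideal_mult[OF is_ideal_ideal_gen]) blast
  then have "0 + var y * f \<in> gvd_N y I + ideal_gen {var y}"
    using ideal_0[OF is_ideal_N] by (intro set_plus_intro) (simp_all add: mult.commute)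
  ultimately show ?thesis
    by (simp add: init_eq)
qed

text \<open>Multiplication by \<open>y\<close> puts a coefficient of \<open>f\<close> into \<open>leading (Suc d)\<close>, hence into \<open>C\<close>; the argument
  repeated for this coefficient, which is free of \<open>y\<close>, brings the degree down to one.\<close>

lemma coeff_C:
  assumes "f \<in> gvd_C y I"
  shows "coeff (in_var y f) d \<in> leading 1"
proof -
  let ?l = "coeff (in_var y f) d"
  have "coeff (in_var y (var y * f)) (Suc d) \<in> leading (Suc d)"
    using var_mult_C[OF assms] by (rule coeff_init_ideal)
  then have l: "?l \<in> leading (Suc d)"
    by simp
  then have "?l \<in> gvd_C y I"
    using leading_subset_C by blast
  then have "coeff (in_var y (var y * ?l)) 1 \<in> leading 1"
    by (intro coeff_init_ideal var_mult_C)
  then show ?thesis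
    using leading_free[OF l] by (simp add: in_var_free)
qed

lemma leading_subset_leading_1: "leading d \<subseteq> leading 1"
proof
  fix l assume l: "l \<in> leading d"
  then have "coeff (in_var y l) 0 \<in> leading 1"
    using leading_subset_C by (intro coeff_C) blast
  then show "l \<in> leading 1"
    using leading_free[OF l] by (simp add: in_var_free)
qed

lemma leading_1_lift:
  assumes "l \<in> leading 1"
  obtains r where "free_of y r" "var y * l + r \<in> I"
proof -
  obtain h where h: "h \<in> I" "degree (in_var y h) \<le> 1" "coeff (in_var y h) 1 = l"
    using assms by (auto simp: leading_def lead_coeffs_def)
  have "in_var y h = [:coeff (in_var y h) 0, l:]"
    using h by (intro poly_eqI) (auto simp: coeff_pCons coeff_eq_0 split: nat.split)
  then have "h = coeff (in_var y h) 0 + var y * l"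
    using poly_in_var[of y h] by (metis poly_pCons poly_0 mult_zero_right add_0_right)
  then show ?thesis
    using that[of "coeff (in_var y h) 0"] h(1) free_of_coeff_in_var by (metis add.commute)
qed

lemma coeff_N:
  assumes "f \<in> gvd_N y I"
  shows "coeff (in_var y f) d \<in> gvd_N y I"
proof -
  let ?J = "\<lambda>d::nat. {f \<in> I. free_of y f}"
  have "is_ideal {f. \<forall>d. coeff (in_var y f) d \<in> ?J d}"
  proof (rule is_ideal_coeffs)
    show "ideal_within (polys_in (- {y})) {f \<in> I. free_of y f}"
      using I by (auto simp: ideal_within_def polys_in_Compl free_of_add free_of_mult intro: ideal_0 ideal_add ideal_mult)
  qed simp
  moreover have "{f \<in> I. free_of y f} \<subseteq> {f. \<forall>d. coeff (in_var y f) d \<in> ?J d}"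
    using ideal_0[OF I] by (auto simp: in_var_free coeff_pCons split: nat.split)
  ultimately have "gvd_N y I \<subseteq> {f. \<forall>d. coeff (in_var y f) d \<in> ?J d}"
    unfolding gvd_N_def by (rule ideal_gen_minimal)
  then show ?thesis
    using assms free_in_N by blast
qed

lemma N_iff_coeffs: "f \<in> gvd_N y I \<longleftrightarrow> (\<forall>d. coeff (in_var y f) d \<in> gvd_N y I)"
  using coeff_N mem_ideal_if_coeffs[OF is_ideal_N] by blast

lemma nonzerodivisor_var_N: "nonzerodivisor_mod (gvd_N y I) (var y)"
  unfolding nonzerodivisor_mod_def
proof (intro allI impI)
  fix b assume "var y * b \<in> gvd_N y I"
  then have "coeff (in_var y (var y * b)) (Suc d) \<in> gvd_N y I" for d
    by (rule coeff_N)
  then show "b \<in> gvd_N y I"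
    by (subst N_iff_coeffs) simp
qed

lemma nonzerodivisor_var_C: "nonzerodivisor_mod (gvd_C y I) (var y)"
  unfolding gvd_C_def by (rule nonzerodivisor_mod_saturation)

text \<open>Descending induction on the coefficients of the cofactor: modulo those already known to lie in
  \<open>N\<close>, the product has \<open>u\<close> times the next one among its coefficients.\<close>

lemma nonzerodivisor_linear:
  assumes u: "free_of y u" "nonzerodivisor_mod (gvd_N y I) u" and r: "free_of y r"
  shows "nonzerodivisor_mod (gvd_N y I) (var y * u + r)"
  unfolding nonzerodivisor_mod_def
proof (intro allI impI)
  fix b assume b: "(var y * u + r) * b \<in> gvd_N y I"
  let ?c = "coeff (in_var y b)"
  have step: "?c d \<in> gvd_N y I" if "?c (Suc d) \<in> gvd_N y I" for d
  proof -
    have "coeff (in_var y ((var y * u + r) * b)) (Suc d) = u * ?c d + r * ?c (Suc d)"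
      using u r by (simp add: in_var_free distrib_right)
    then have "u * ?c d + r * ?c (Suc d) \<in> gvd_N y I"
      using coeff_N[OF b, of "Suc d"] by simp
    moreover have "r * ?c (Suc d) \<in> gvd_N y I"
      using that by (rule ideal_mult[OF is_ideal_N])
    ultimately have "(u * ?c d + r * ?c (Suc d)) - r * ?c (Suc d) \<in> gvd_N y I"
      by (rule ideal_diff[OF is_ideal_N])
    then show ?thesis
      using u(2) by (simp add: nonzerodivisor_mod_def)
  qed
  have "?c d \<in> gvd_N y I" for d
  proof (cases "d \<le> Suc (degree (in_var y b))")
    case True
    then show ?thesis
    proof (induction rule: inc_induct)
      case base
      then show ?case using ideal_0[OF is_ideal_N] by (simp add: coeff_eq_0)
    qed (rule step)
  next
    case False
    then show ?thesis using ideal_0[OF is_ideal_N] by (simp add: coeff_eq_0)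
  qed
  then show "b \<in> gvd_N y I"
    by (subst N_iff_coeffs) simp
qed

end

locale vertex_decomposition_pair = vertex_decomposition +
  fixes u r
  assumes free_u: "free_of y u" and free_r: "free_of y r" and in_I: "var y * u + r \<in> I"
begin

text \<open>The terms with \<open>y\<close> cancel in the difference, which is thus one of the generators of \<open>N\<close>.\<close>

lemma cross_difference:
  assumes "free_of y l" "free_of y r'" "var y * l + r' \<in> I"
  shows "l * (var y * u + r) - (var y * l + r') * u \<in> gvd_N y I"
proof (rule free_in_N)
  show "l * (var y * u + r) - (var y * l + r') * u \<in> I"
    using assms(3) in_I by (intro ideal_diff[OF I] ideal_mult[OF I] ideal_mult_right[OF I])
  have "free_of y (l * r - r' * u)"
    using assms free_u free_r by (intro free_of_diff free_of_mult)
  then show "free_of y (l * (var y * u + r) - (var y * l + r') * u)"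
    by (simp add: algebra_simps)
qed

text \<open>Each coefficient of \<open>f\<close> is a leading coefficient in degree one, and the corresponding elements of \<open>I\<close>
  are recombined with the same powers of \<open>y\<close>.\<close>

lemma fraction_image:
  assumes f: "f \<in> gvd_C y I"
  shows "\<exists>h\<in>I. f * (var y * u + r) - h * u \<in> gvd_N y I"
proof -
  let ?c = "coeff (in_var y f)"
  have "\<exists>r'. free_of y r' \<and> var y * ?c i + r' \<in> I" for i
    using leading_1_lift[OF coeff_C[OF f]] by metis
  then obtain r' where r': "\<And>i. free_of y (r' i)" "\<And>i. var y * ?c i + r' i \<in> I"
    by metis
  let ?h = "\<Sum>i\<le>degree (in_var y f). (var y * ?c i + r' i) * var y ^ i"
  have "f * (var y * u + r) = (\<Sum>i\<le>degree (in_var y f). ?c i * (var y * u + r) * var y ^ i)"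
    by (subst mpol_eq_sum_coeffs[of f y]) (simp add: sum_distrib_left sum_distrib_right ac_simps)
  moreover have "?h * u = (\<Sum>i\<le>degree (in_var y f). (var y * ?c i + r' i) * u * var y ^ i)"
    by (simp add: sum_distrib_left sum_distrib_right ac_simps)
  ultimately have "f * (var y * u + r) - ?h * u =
      (\<Sum>i\<le>degree (in_var y f). (?c i * (var y * u + r) - (var y * ?c i + r' i) * u) * var y ^ i)"
    by (simp only: left_diff_distrib sum_subtractf)
  also have "\<dots> \<in> gvd_N y I"
    using r' by (intro ideal_sum[OF is_ideal_N] ideal_mult_right[OF is_ideal_N] cross_difference free_of_coeff_in_var)
  finally show ?thesis
    using r' by (intro bexI[of _ ?h] ideal_sum[OF I] ideal_mult_right[OF I])
qed

text \<open>Division of \<open>h\<close> by elements of \<open>I\<close> of degree one in \<open>y\<close> stops in degree zero, that is, in \<open>N\<close>; the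
  partner of \<open>h\<close> collects the leading coefficients met on the way.\<close>

lemma fraction_preimage:
  assumes "h \<in> I"
  shows "\<exists>f\<in>gvd_C y I. f * (var y * u + r) - h * u \<in> gvd_N y I"
  using assms
proof (induction "degree (in_var y h)" arbitrary: h rule: less_induct)
  case less
  show ?case
  proof (cases "degree (in_var y h)")
    case 0
    then have "- (h * u) \<in> gvd_N y I"
      using free_in_N[OF less.prems] by (simp add: free_of_iff ideal_minus[OF is_ideal_N] ideal_mult_right[OF is_ideal_N])
    then show ?thesis
      using ideal_0[OF is_ideal_C] by (intro bexI[of _ 0]) auto
  next
    case (Suc d)
    define l where "l = lead_coeff (in_var y h)"
    have "l \<in> leading (Suc d)"
      using less.prems Suc by (force simp: l_def leading_def lead_coeffs_def)
    then have l: "l \<in> leading 1" "l \<in> gvd_C y I" "free_of y l"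
      using leading_subset_leading_1 leading_subset_C leading_free by blast+
    obtain r' where r': "free_of y r'" "var y * l + r' \<in> I"
      using leading_1_lift[OF l(1)] .
    define h' where "h' = h - var y ^ d * (var y * l + r')"
    have "in_var y h' = in_var y h - (monom l (Suc d) + monom r' d)"
      using l r' by (simp add: h'_def in_var_free monom_altdef distrib_left algebra_simps)
    then have "degree (in_var y h') \<le> d"
      using Suc by (intro degree_le allI impI) (auto simp: coeff_eq_0 l_def Suc_lessI)
    moreover have "h' \<in> I"
      unfolding h'_def by (intro ideal_diff[OF I] ideal_mult[OF I] less.prems r')
    ultimately obtain f where f: "f \<in> gvd_C y I" "f * (var y * u + r) - h' * u \<in> gvd_N y I"
      using less.hyps[of h'] Suc by auto
    have "(f + var y ^ d * l) * (var y * u + r) - h * u =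
        (f * (var y * u + r) - h' * u) + var y ^ d * (l * (var y * u + r) - (var y * l + r') * u)"
      by (simp add: h'_def algebra_simps)
    also have "\<dots> \<in> gvd_N y I"
      using f l r' by (intro ideal_add[OF is_ideal_N] ideal_mult[OF is_ideal_N] cross_difference)
    finally show ?thesis
      using f l by (intro bexI[of _ "f + var y ^ d * l"] ideal_add[OF is_ideal_C] ideal_mult[OF is_ideal_C])
  qed
qed

end

section \<open>Lifting the splitting\<close>

theorem theorem3p3:
  fixes p :: nat
    and y :: "'n::{finite,linorder}"
    and I :: "('n, 'k::field) mpol set"
    and g :: "('n, 'k) mpol"
  assumes "prime p" and "CHAR('k) = p"
    and perfect: "surj (\<lambda>c::'k. c ^ p)"
    and "is_ideal I"
    and "geometric_vertex_decomposition y I" and "\<not> degenerate_gvd y I"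
    and "free_of y g"
    and "frobenius_splitting p (\<lambda>a. trace p ((var y * g) ^ (p - 1) * a))"
    and "compatibly_split (\<lambda>a. trace p ((var y * g) ^ (p - 1) * a)) (gvd_C y I)"
    and "compatibly_split (\<lambda>a. trace p ((var y * g) ^ (p - 1) * a)) (gvd_N y I)"
    and "\<exists>u. u \<in> gvd_C y I - \<Union> (associated_primes (gvd_N y I)) \<and> u dvd g"
  shows "\<exists>r. free_of y r \<and>
    frobenius_splitting p (\<lambda>a. trace p ((var y * g + r) ^ (p - 1) * a)) \<and>
    compatibly_split (\<lambda>a. trace p ((var y * g + r) ^ (p - 1) * a)) I \<and>
    var y * g + r \<in> I \<and>
    (\<exists>\<psi>. gvd_isomorphism y I \<psi>) \<and>
    (\<forall>\<psi>. gvd_isomorphism y I \<psi> \<longrightarrow> var y * g + r \<in> \<psi> (g +o gvd_N y I))"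
proof -
  let ?C = "gvd_C y I" and ?N = "gvd_N y I"
  note char = \<open>prime p\<close> \<open>CHAR('k) = p\<close> perfect
  interpret vertex_decomposition y I
    using assms(4,5) by unfold_locales (simp_all add: geometric_vertex_decomposition_def)
  obtain u where u: "u \<in> ?C" "u \<notin> \<Union> (associated_primes ?N)" and "u dvd g"
    using assms(11) by blast
  then obtain v where g: "g = u * v"
    by (elim dvdE)
  have uN: "nonzerodivisor_mod ?N u"
    by (rule nonzerodivisor_mod_if_not_in_associated_primes[OF noetherian_mpol is_ideal_N u(2)])
  have one: "trace p ((var y * g) ^ (p - 1)) = 1"
    using assms(8) by (simp add: frobenius_splitting_def)
  \<comment> \<open>A splitting cannot be zero, and \<open>p - 1\<close> is positive.\<close>
  have "g \<noteq> 0"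
  proof
    assume "g = 0"
    moreover have "p - 1 > 0" using prime_gt_1_nat[OF \<open>prime p\<close>] by simp
    ultimately show False using one by (simp add: zero_power)
  qed
  then have free: "free_of y u" "free_of y v"
    using free_of_factor[of y u v] \<open>free_of y g\<close> g by simp_all
  have "coeff (in_var y u) 0 \<in> leading 1"
    using u(1) by (rule coeff_C)
  then have "u \<in> leading 1"
    using free by (simp add: in_var_free)
  then obtain r\<^sub>0 where r\<^sub>0: "free_of y r\<^sub>0" "var y * u + r\<^sub>0 \<in> I"
    by (rule leading_1_lift)
  define w where "w = var y * u + r\<^sub>0"
  interpret pair: vertex_decomposition_pair y I u r\<^sub>0
    using free r\<^sub>0 by unfold_locales
  define r where "r = v * r\<^sub>0"
  have F: "var y * g + r = v * w"
    by (simp add: g r_def w_def algebra_simps)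
  have free_r: "free_of y r"
    unfolding r_def using free r\<^sub>0 by (intro free_of_mult)
  have wN: "nonzerodivisor_mod ?N w"
    unfolding w_def by (rule nonzerodivisor_linear[OF free(1) uN r\<^sub>0(1)])
  have F_in_I: "var y * g + r \<in> I"
    unfolding F w_def using r\<^sub>0(2) by (rule ideal_mult[OF I])
  have linear: "trace p (a ^ p * b) = a * trace p b" and additive: "trace p (a + b) = trace p a + trace p b"
    for a b :: "('n, 'k) mpol"
    using char by (rule trace_power_mult, rule trace_add)

  have "frobenius_splitting p (\<lambda>a. trace p ((var y * g + r) ^ (p - 1) * a))"
    unfolding frobenius_splitting_def
  proof (intro conjI allI)
    fix a b
    show "trace p ((var y * g + r) ^ (p - 1) * (a + b)) =
        trace p ((var y * g + r) ^ (p - 1) * a) + trace p ((var y * g + r) ^ (p - 1) * b)"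
      by (simp only: distrib_left additive)
    show "trace p ((var y * g + r) ^ (p - 1) * (a ^ p * b)) = a * trace p ((var y * g + r) ^ (p - 1) * b)"
      by (simp only: mult.left_commute[of _ "a ^ p"] linear)
    show "trace p ((var y * g + r) ^ (p - 1) * 1) = 1"
      using trace_power_add_free[OF char \<open>free_of y g\<close> free_r] one by simp
  qed
  moreover have "compatibly_split (\<lambda>a. trace p ((var y * g + r) ^ (p - 1) * a)) I"
    unfolding F
  proof (rule compatibly_split_by_fraction[where T = "trace p" and C = ?C and N = ?N and x = "var y" and u = u])
    show "p > 0" using \<open>prime p\<close> by (rule prime_gt_0_nat)
  qed (use linear additive I is_ideal_C is_ideal_N N_subset_I nonzerodivisor_var_C nonzerodivisor_var_N uN
      pair.fraction_image pair.fraction_preimage assms(9,10) in \<open>simp_all add: w_def g\<close>)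
  moreover have "\<exists>\<psi>. gvd_isomorphism y I \<psi>"
  proof -
    have "gvd_pair y I u r\<^sub>0"
      using u free r\<^sub>0 uN wN by (simp add: gvd_pair_def w_def)
    then show ?thesis
      using quotient_module_iso_by_fraction[OF is_ideal_C I is_ideal_N uN wN[unfolded w_def]
          pair.fraction_image pair.fraction_preimage]
      unfolding gvd_isomorphism_def by blast
  qed
  moreover have "var y * g + r \<in> \<psi> (g +o ?N)" if iso: "gvd_isomorphism y I \<psi>" for \<psi>
  proof -
    obtain q r' where pair': "gvd_pair y I q r'"
      and \<psi>: "\<forall>f\<in>?C. \<exists>h\<in>I. f * (var y * q + r') - h * q \<in> ?N \<and> \<psi> (f +o ?N) = h +o ?N"
      using iso unfolding gvd_isomorphism_def by blast
    have "g \<in> ?C"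
      unfolding g using u(1) by (rule ideal_mult_right[OF is_ideal_C])
    then obtain h where h: "g * (var y * q + r') - h * q \<in> ?N" "\<psi> (g +o ?N) = h +o ?N"
      using \<psi> by blast
    \<comment> \<open>\<open>\<psi>\<close> may come from another pair \<open>(q, r')\<close>, but the fractions \<open>(y * q + r') / q\<close> and \<open>w / u\<close> agree
      modulo \<open>N\<close>.\<close>
    have "q * w - (var y * q + r') * u \<in> ?N"
      unfolding w_def using pair' by (intro pair.cross_difference) (auto simp: gvd_pair_def)
    then have "v * (q * w - (var y * q + r') * u) + (g * (var y * q + r') - h * q) \<in> ?N"
      using h(1) by (intro ideal_add[OF is_ideal_N] ideal_mult[OF is_ideal_N])
    also have "v * (q * w - (var y * q + r') * u) + (g * (var y * q + r') - h * q) = q * (v * w - h)"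
      by (simp add: g algebra_simps)
    finally have "q * (v * w - h) \<in> ?N" .
    then have "var y * g + r - h \<in> ?N"
      using pair' unfolding F gvd_pair_def nonzerodivisor_mod_def by blast
    then show ?thesis
      by (simp only: h(2) set_minus_plus)
  qed
  ultimately show ?thesis
    using free_r F_in_I by blast
qed

end
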